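(* (Adequacy of encoding of emptiness.) For every positive type name $t$ of the object signature, there is a bijection between the circular derivations of $t\ \mathsf{empty}$ and the canonical forms of the CoLF type $\mathtt{empty}\ \ulcorner t\urcorner$.
   Context: Positive equirecursive types: $\tau^+::=t_1^+\otimes t_2^+\mid\mathbf 1\mid t_1^+\oplus t_2^+\mid\mathbf 0$ over type names $t^+$ defined by an object signature of definitions $t^+=\tau^+$. The judgment $t\ \mathsf{empty}$ is defined coinductively (derivations may be circular/infinite) by: $\mathbf 0\ \mathsf{empty}$; if $t=t_1\oplus t_2$ in the signature and $t_1\ \mathsf{empty}$ and $t_2\ \mathsf{empty}$ then $t\ \mathsf{empty}$; if $t=t_1\otimes t_2$ and $t_1\ \mathsf{empty}$ then $t\ \mathsf{empty}$; if $t=t_1\otimes t_2$ and $t_2\ \mathsf{empty}$ then $t\ \mathsf{empty}$. CoLF encoding: postp : cotype; times : postp -> postp -> postp; one : postp; plus : postp -> postp -> postp; zero : postp; empty : postp -> cotype; zero_emp : empty zero; plus_emp : empty T1 -> empty T2 -> empty (plus T1 T2); times_emp_1 : empty T1 -> empty (times T1 T2); times_emp_2 : empty T2 -> empty (times T1 T2). Each object definition $t=\tau$ is encoded as a CoLF recursion constant $\mathtt t:\mathtt{postp}=\ulcorner\tau\urcorner$ (with times/one/plus/zero for $\otimes,\mathbf 1,\oplus,\mathbf 0$), and cycles in derivations as CoLF recursion constants; CoLF terms are identified up to their infinite unfoldings. *)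

theory Defs
  imports Main
begin

section \<open>The fragment of CoLF in which every type family is a cotype\<close>

text \<open>
  Terms are in canonical (beta-normal, eta-long) spine form, with de Bruijn indices. Binders and
  spine entries come in two modes: ordinary ones, and prepattern ones, where the argument of a
  prepattern product can only be a prepattern variable. Recursion constants have prepattern
  product types, so they are only ever applied to variables.

  CoLF additionally has inductive families (of kind \<open>type\<close>) and a validity condition on the
  infinite traces that pass through constructors of such families. As there are no such families
  here, the validity condition is vacuous, and \<open>cotype\<close> is the only base kind.
\<close>

datatype mode = Ord | Pre

datatype 'x arg = Arg 'x | PArg nat

datatype ('c, 'r) head = Var nat | Con 'c | Rec 'r

datatype ('c, 'r) tm = Lam mode "('c, 'r) tm" | App "('c, 'r) head" "('c, 'r) tm arg list"

datatype ('a, 'c, 'r) ty =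
  Atom 'a "('c, 'r) tm arg list"
| Pi mode "('a, 'c, 'r) ty" "('a, 'c, 'r) ty"

datatype ('a, 'c, 'r) kd = Cotype | KPi mode "('a, 'c, 'r) ty" "('a, 'c, 'r) kd"

datatype ('a, 'c, 'r) decl =
  is_FamDecl: FamDecl 'a "('a, 'c, 'r) kd"
| is_ConDecl: ConDecl 'c "('a, 'c, 'r) ty"
| is_RecDecl: RecDecl 'r "('a, 'c, 'r) ty" "('c, 'r) tm"

type_synonym ('a, 'c, 'r) lfsig = "('a, 'c, 'r) decl list"

type_synonym ('a, 'c, 'r) ctxt = "(mode \<times> ('a, 'c, 'r) ty) list"


subsection \<open>Renaming\<close>

fun up :: "(nat \<Rightarrow> nat) \<Rightarrow> nat \<Rightarrow> nat" where
  "up f 0 = 0"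
| "up f (Suc i) = Suc (f i)"

fun ren_head :: "(nat \<Rightarrow> nat) \<Rightarrow> ('c, 'r) head \<Rightarrow> ('c, 'r) head" where
  "ren_head f (Var i) = Var (f i)"
| "ren_head f (Con c) = Con c"
| "ren_head f (Rec r) = Rec r"

fun map_var_arg :: "(nat \<Rightarrow> nat) \<Rightarrow> ('x \<Rightarrow> 'y) \<Rightarrow> 'x arg \<Rightarrow> 'y arg" where
  "map_var_arg f g (Arg M) = Arg (g M)"
| "map_var_arg f g (PArg i) = PArg (f i)"

lemma map_var_arg_cong [fundef_cong]:
  assumes "f = f'" "a = a'" "\<And>x. x \<in> set_arg a' \<Longrightarrow> g x = g' x"
  shows "map_var_arg f g a = map_var_arg f' g' a'"
  using assms by (cases a') auto

lemma size_set_arg: "x \<in> set_arg a \<Longrightarrow> g x < size_arg g a"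
  by (cases a) auto

function (sequential) ren :: "(nat \<Rightarrow> nat) \<Rightarrow> ('c, 'r) tm \<Rightarrow> ('c, 'r) tm" where
  "ren f (Lam m M) = Lam m (ren (up f) M)"
| "ren f (App h S) = App (ren_head f h) (map (map_var_arg f (ren f)) S)"
  by pat_completeness auto
termination
proof (relation "measure (\<lambda>(f, M). size M)", goal_cases)
  case (3 f h S a M)
  then have "size M < size_arg size a" "size_arg size a \<le> size_list (size_arg size) S"
    by (auto intro: size_set_arg size_list_estimation')
  then show ?case by simp
qed auto

abbreviation ren_arg :: "(nat \<Rightarrow> nat) \<Rightarrow> ('c, 'r) tm arg \<Rightarrow> ('c, 'r) tm arg" where
  "ren_arg f \<equiv> map_var_arg f (ren f)"

fun ren_ty :: "(nat \<Rightarrow> nat) \<Rightarrow> ('a, 'c, 'r) ty \<Rightarrow> ('a, 'c, 'r) ty" where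
  "ren_ty f (Atom a S) = Atom a (map (ren_arg f) S)"
| "ren_ty f (Pi m A B) = Pi m (ren_ty f A) (ren_ty (up f) B)"

fun ren_kd :: "(nat \<Rightarrow> nat) \<Rightarrow> ('a, 'c, 'r) kd \<Rightarrow> ('a, 'c, 'r) kd" where
  "ren_kd f Cotype = Cotype"
| "ren_kd f (KPi m A K) = KPi m (ren_ty f A) (ren_kd (up f) K)"

text \<open>Replaces variable 0 by variable \<open>x\<close> and lowers all other indices.\<close>

fun inst :: "nat \<Rightarrow> nat \<Rightarrow> nat" where
  "inst x 0 = x"
| "inst x (Suc i) = i"


subsection \<open>Hereditary substitution\<close>

text \<open>
  \<open>hsub N k M M'\<close>: substituting \<open>N\<close> for the ordinary variable \<open>k\<close> in \<open>M\<close> yields \<open>M'\<close>;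
  \<open>hred N S R\<close>: applying \<open>N\<close> to the spine \<open>S\<close> yields \<open>R\<close>. Being inductively defined relations,
  they need no index by simple types to ensure termination.
\<close>

inductive hsub :: "('c, 'r) tm \<Rightarrow> nat \<Rightarrow> ('c, 'r) tm \<Rightarrow> ('c, 'r) tm \<Rightarrow> bool"
  and hsubs :: "('c, 'r) tm \<Rightarrow> nat \<Rightarrow> ('c, 'r) tm arg list \<Rightarrow> ('c, 'r) tm arg list \<Rightarrow> bool"
  and hred :: "('c, 'r) tm \<Rightarrow> ('c, 'r) tm arg list \<Rightarrow> ('c, 'r) tm \<Rightarrow> bool"
where
  hsub_Lam: "hsub (ren Suc N) (Suc k) M M' \<Longrightarrow> hsub N k (Lam m M) (Lam m M')"
| hsub_eq: "hsubs N k S S' \<Longrightarrow> hred N S' R \<Longrightarrow> hsub N k (App (Var k) S) R"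
| hsub_less: "i < k \<Longrightarrow> hsubs N k S S' \<Longrightarrow> hsub N k (App (Var i) S) (App (Var i) S')"
| hsub_greater: "k < i \<Longrightarrow> hsubs N k S S' \<Longrightarrow> hsub N k (App (Var i) S) (App (Var (i - 1)) S')"
| hsub_Con: "hsubs N k S S' \<Longrightarrow> hsub N k (App (Con c) S) (App (Con c) S')"
| hsub_Rec: "hsubs N k S S' \<Longrightarrow> hsub N k (App (Rec r) S) (App (Rec r) S')"
| hsubs_Nil: "hsubs N k [] []"
| hsubs_Arg: "hsub N k M M' \<Longrightarrow> hsubs N k S S' \<Longrightarrow> hsubs N k (Arg M # S) (Arg M' # S')"
| hsubs_PArg_less: "i < k \<Longrightarrow> hsubs N k S S' \<Longrightarrow> hsubs N k (PArg i # S) (PArg i # S')"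
| hsubs_PArg_greater: "k < i \<Longrightarrow> hsubs N k S S' \<Longrightarrow> hsubs N k (PArg i # S) (PArg (i - 1) # S')"
| hred_Nil: "hred (App h S) [] (App h S)"
| hred_Arg: "hsub N 0 M M' \<Longrightarrow> hred M' S R \<Longrightarrow> hred (Lam Ord M) (Arg N # S) R"
| hred_PArg: "hred (ren (inst x) M) S R \<Longrightarrow> hred (Lam Pre M) (PArg x # S) R"

inductive hsub_ty :: "('c, 'r) tm \<Rightarrow> nat \<Rightarrow> ('a, 'c, 'r) ty \<Rightarrow> ('a, 'c, 'r) ty \<Rightarrow> bool" where
  "hsubs N k S S' \<Longrightarrow> hsub_ty N k (Atom a S) (Atom a S')"
| "hsub_ty N k A A' \<Longrightarrow> hsub_ty (ren Suc N) (Suc k) B B' \<Longrightarrow> hsub_ty N k (Pi m A B) (Pi m A' B')"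

inductive hsub_kd :: "('c, 'r) tm \<Rightarrow> nat \<Rightarrow> ('a, 'c, 'r) kd \<Rightarrow> ('a, 'c, 'r) kd \<Rightarrow> bool" where
  "hsub_kd N k Cotype Cotype"
| "hsub_ty N k A A' \<Longrightarrow> hsub_kd (ren Suc N) (Suc k) K K' \<Longrightarrow>
    hsub_kd N k (KPi m A K) (KPi m A' K')"


subsection \<open>Infinite unfolding and definitional equality\<close>

text \<open>
  Unfolding all recursion constants turns a term into a possibly infinite Boehm tree. Terms are
  equal if they unfold to the same tree.
\<close>

datatype 'c bhead = BVar nat | BCon 'c

codatatype 'c btree = BLam mode "'c btree" | BApp "'c bhead" "'c btree arg list"

inductive hnf ::
  "('a, 'c, 'r) lfsig \<Rightarrow> ('c, 'r) tm \<Rightarrow> 'c bhead \<Rightarrow> ('c, 'r) tm arg list \<Rightarrow> bool" for \<Sigma> where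
  hnf_Var: "hnf \<Sigma> (App (Var i) S) (BVar i) S"
| hnf_Con: "hnf \<Sigma> (App (Con c) S) (BCon c) S"
| hnf_Rec: "RecDecl r A N \<in> set \<Sigma> \<Longrightarrow> hred N S R \<Longrightarrow> hnf \<Sigma> R h S' \<Longrightarrow> hnf \<Sigma> (App (Rec r) S) h S'"

coinductive unfolds :: "('a, 'c, 'r) lfsig \<Rightarrow> ('c, 'r) tm \<Rightarrow> 'c btree \<Rightarrow> bool" for \<Sigma> where
  unfolds_Lam: "unfolds \<Sigma> M T \<Longrightarrow> unfolds \<Sigma> (Lam m M) (BLam m T)"
| unfolds_App: "hnf \<Sigma> R h S \<Longrightarrow> list_all2 (rel_arg (unfolds \<Sigma>)) S Ts \<Longrightarrow> unfolds \<Sigma> R (BApp h Ts)"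
  monos list.rel_mono_strong arg.rel_mono_strong

definition tm_eq :: "('a, 'c, 'r) lfsig \<Rightarrow> ('c, 'r) tm \<Rightarrow> ('c, 'r) tm \<Rightarrow> bool" where
  "tm_eq \<Sigma> M N \<longleftrightarrow> (\<exists>T. unfolds \<Sigma> M T \<and> unfolds \<Sigma> N T)"

inductive ty_eq :: "('a, 'c, 'r) lfsig \<Rightarrow> ('a, 'c, 'r) ty \<Rightarrow> ('a, 'c, 'r) ty \<Rightarrow> bool" for \<Sigma> where
  "list_all2 (rel_arg (tm_eq \<Sigma>)) S S' \<Longrightarrow> ty_eq \<Sigma> (Atom a S) (Atom a S')"
| "ty_eq \<Sigma> A A' \<Longrightarrow> ty_eq \<Sigma> B B' \<Longrightarrow> ty_eq \<Sigma> (Pi m A B) (Pi m A' B')"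


subsection \<open>Typing\<close>

definition lookup :: "('a, 'c, 'r) ctxt \<Rightarrow> nat \<Rightarrow> mode \<Rightarrow> ('a, 'c, 'r) ty \<Rightarrow> bool" where
  "lookup \<Gamma> i m A \<longleftrightarrow>
     i < length \<Gamma> \<and> m = fst (\<Gamma> ! i) \<and> A = ren_ty (\<lambda>j. j + Suc i) (snd (\<Gamma> ! i))"

text \<open>
  \<open>chk \<Sigma> \<Gamma> M A\<close>: \<open>M\<close> checks against \<open>A\<close>; \<open>syn \<Sigma> \<Gamma> R P\<close>: the neutral term \<open>R\<close> synthesizes the atomic
  type \<open>P\<close>; \<open>spn \<Sigma> \<Gamma> S A P\<close>: applying a head of type \<open>A\<close> to the spine \<open>S\<close> gives type \<open>P\<close>.
\<close>

inductive chk :: "('a, 'c, 'r) lfsig \<Rightarrow> ('a, 'c, 'r) ctxt \<Rightarrow> ('c, 'r) tm \<Rightarrow> ('a, 'c, 'r) ty \<Rightarrow> bool"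
  and syn :: "('a, 'c, 'r) lfsig \<Rightarrow> ('a, 'c, 'r) ctxt \<Rightarrow> ('c, 'r) tm \<Rightarrow> ('a, 'c, 'r) ty \<Rightarrow> bool"
  and spn :: "('a, 'c, 'r) lfsig \<Rightarrow> ('a, 'c, 'r) ctxt \<Rightarrow> ('c, 'r) tm arg list \<Rightarrow>
    ('a, 'c, 'r) ty \<Rightarrow> ('a, 'c, 'r) ty \<Rightarrow> bool"
  for \<Sigma>
where
  chk_Lam: "chk \<Sigma> ((m, A) # \<Gamma>) M B \<Longrightarrow> chk \<Sigma> \<Gamma> (Lam m M) (Pi m A B)"
| chk_App: "syn \<Sigma> \<Gamma> (App h S) P' \<Longrightarrow> ty_eq \<Sigma> P' (Atom a S') \<Longrightarrow> chk \<Sigma> \<Gamma> (App h S) (Atom a S')"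
| syn_Var: "lookup \<Gamma> i m A \<Longrightarrow> spn \<Sigma> \<Gamma> S A P \<Longrightarrow> syn \<Sigma> \<Gamma> (App (Var i) S) P"
| syn_Con: "ConDecl c A \<in> set \<Sigma> \<Longrightarrow> spn \<Sigma> \<Gamma> S A P \<Longrightarrow> syn \<Sigma> \<Gamma> (App (Con c) S) P"
| syn_Rec: "RecDecl r A N \<in> set \<Sigma> \<Longrightarrow> spn \<Sigma> \<Gamma> S A P \<Longrightarrow> syn \<Sigma> \<Gamma> (App (Rec r) S) P"
| spn_Nil: "spn \<Sigma> \<Gamma> [] (Atom a S) (Atom a S)"
| spn_Arg: "chk \<Sigma> \<Gamma> M A \<Longrightarrow> hsub_ty M 0 B B' \<Longrightarrow> spn \<Sigma> \<Gamma> S B' P \<Longrightarrow>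
    spn \<Sigma> \<Gamma> (Arg M # S) (Pi Ord A B) P"
| spn_PArg: "lookup \<Gamma> x Pre A' \<Longrightarrow> ty_eq \<Sigma> A' A \<Longrightarrow> spn \<Sigma> \<Gamma> S (ren_ty (inst x) B) P \<Longrightarrow>
    spn \<Sigma> \<Gamma> (PArg x # S) (Pi Pre A B) P"

inductive kspn :: "('a, 'c, 'r) lfsig \<Rightarrow> ('a, 'c, 'r) ctxt \<Rightarrow> ('c, 'r) tm arg list \<Rightarrow>
    ('a, 'c, 'r) kd \<Rightarrow> bool"
  for \<Sigma> \<Gamma>
where
  "kspn \<Sigma> \<Gamma> [] Cotype"
| "chk \<Sigma> \<Gamma> M A \<Longrightarrow> hsub_kd M 0 K K' \<Longrightarrow> kspn \<Sigma> \<Gamma> S K' \<Longrightarrow> kspn \<Sigma> \<Gamma> (Arg M # S) (KPi Ord A K)"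
| "lookup \<Gamma> x Pre A' \<Longrightarrow> ty_eq \<Sigma> A' A \<Longrightarrow> kspn \<Sigma> \<Gamma> S (ren_kd (inst x) K) \<Longrightarrow>
    kspn \<Sigma> \<Gamma> (PArg x # S) (KPi Pre A K)"

inductive wf_ty :: "('a, 'c, 'r) lfsig \<Rightarrow> ('a, 'c, 'r) ctxt \<Rightarrow> ('a, 'c, 'r) ty \<Rightarrow> bool" for \<Sigma> where
  "FamDecl a K \<in> set \<Sigma> \<Longrightarrow> kspn \<Sigma> \<Gamma> S K \<Longrightarrow> wf_ty \<Sigma> \<Gamma> (Atom a S)"
| "wf_ty \<Sigma> \<Gamma> A \<Longrightarrow> wf_ty \<Sigma> ((m, A) # \<Gamma>) B \<Longrightarrow> wf_ty \<Sigma> \<Gamma> (Pi m A B)"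

inductive wf_kd :: "('a, 'c, 'r) lfsig \<Rightarrow> ('a, 'c, 'r) ctxt \<Rightarrow> ('a, 'c, 'r) kd \<Rightarrow> bool" for \<Sigma> where
  "wf_kd \<Sigma> \<Gamma> Cotype"
| "wf_ty \<Sigma> \<Gamma> A \<Longrightarrow> wf_kd \<Sigma> ((m, A) # \<Gamma>) K \<Longrightarrow> wf_kd \<Sigma> \<Gamma> (KPi m A K)"

fun prepattern :: "('a, 'c, 'r) ty \<Rightarrow> bool" where
  "prepattern (Atom a S) = True"
| "prepattern (Pi m A B) = (m = Pre \<and> prepattern B)"

fun contractive :: "('c, 'r) tm \<Rightarrow> bool" where
  "contractive (Lam m M) = contractive M"
| "contractive (App h S) = (\<forall>r. h \<noteq> Rec r)"

text \<open>
  Declarations are checked against the whole signature, since recursion constants may be mutually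
  recursive.
\<close>

fun wf_decl :: "('a, 'c, 'r) lfsig \<Rightarrow> ('a, 'c, 'r) decl \<Rightarrow> bool" where
  "wf_decl \<Sigma> (FamDecl a K) = wf_kd \<Sigma> [] K"
| "wf_decl \<Sigma> (ConDecl c A) = wf_ty \<Sigma> [] A"
| "wf_decl \<Sigma> (RecDecl r A M) = (wf_ty \<Sigma> [] A \<and> prepattern A \<and> chk \<Sigma> [] M A \<and> contractive M)"

datatype ('a, 'c, 'r) sname = FamName 'a | ConName 'c | RecName 'r

fun decl_name :: "('a, 'c, 'r) decl \<Rightarrow> ('a, 'c, 'r) sname" where
  "decl_name (FamDecl a K) = FamName a"
| "decl_name (ConDecl c A) = ConName c"
| "decl_name (RecDecl r A M) = RecName r"

definition wf_sig :: "('a, 'c, 'r) lfsig \<Rightarrow> bool" where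
  "wf_sig \<Sigma> \<longleftrightarrow> distinct (map decl_name \<Sigma>) \<and> (\<forall>d \<in> set \<Sigma>. wf_decl \<Sigma> d)"

text \<open>
  A canonical form of \<open>A\<close> may involve further recursion constants \<open>\<Delta>\<close> for its own cycles. Taking
  the infinite unfoldings identifies terms that differ only in their use of recursion constants.
\<close>

definition canonical_forms :: "('a, 'c, 'r) lfsig \<Rightarrow> ('a, 'c, 'r) ty \<Rightarrow> 'c btree set" where
  "canonical_forms \<Sigma> A = {T. \<exists>\<Delta> M. (\<forall>d \<in> set \<Delta>. is_RecDecl d) \<and> wf_sig (\<Sigma> @ \<Delta>) \<and>
     chk (\<Sigma> @ \<Delta>) [] M A \<and> unfolds (\<Sigma> @ \<Delta>) M T}"


section \<open>Positive equirecursive types and emptiness\<close>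

datatype 't ptyp = TimesT 't 't | OneT | PlusT 't 't | ZeroT

type_synonym 't osig = "('t \<times> 't ptyp) list"

definition wf_osig :: "'t osig \<Rightarrow> bool" where
  "wf_osig \<Omega> \<longleftrightarrow> distinct (map fst \<Omega>) \<and>
     (\<forall>(t, \<tau>) \<in> set \<Omega>. set_ptyp \<tau> \<subseteq> fst ` set \<Omega>)"

text \<open>
  Every node of a derivation carries the type name \<open>t\<close> of its conclusion \<open>t empty\<close>.
\<close>

codatatype 't deriv =
  ZeroEmp 't
| PlusEmp 't "'t deriv" "'t deriv"
| TimesEmp1 't "'t deriv"
| TimesEmp2 't "'t deriv"

coinductive derives :: "'t osig \<Rightarrow> 't deriv \<Rightarrow> 't \<Rightarrow> bool" for \<Omega> where
  "(t, ZeroT) \<in> set \<Omega> \<Longrightarrow> derives \<Omega> (ZeroEmp t) t"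
| "(t, PlusT t1 t2) \<in> set \<Omega> \<Longrightarrow> derives \<Omega> d1 t1 \<Longrightarrow> derives \<Omega> d2 t2 \<Longrightarrow>
    derives \<Omega> (PlusEmp t d1 d2) t"
| "(t, TimesT t1 t2) \<in> set \<Omega> \<Longrightarrow> derives \<Omega> d t1 \<Longrightarrow> derives \<Omega> (TimesEmp1 t d) t"
| "(t, TimesT t1 t2) \<in> set \<Omega> \<Longrightarrow> derives \<Omega> d t2 \<Longrightarrow> derives \<Omega> (TimesEmp2 t d) t"

inductive_set subderivs :: "'t deriv \<Rightarrow> 't deriv set" for d where
  "d \<in> subderivs d"
| "PlusEmp t d1 d2 \<in> subderivs d \<Longrightarrow> d1 \<in> subderivs d"
| "PlusEmp t d1 d2 \<in> subderivs d \<Longrightarrow> d2 \<in> subderivs d"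
| "TimesEmp1 t d' \<in> subderivs d \<Longrightarrow> d' \<in> subderivs d"
| "TimesEmp2 t d' \<in> subderivs d \<Longrightarrow> d' \<in> subderivs d"

text \<open>
  A circular derivation, i.e. a finite derivation with back edges, denotes a possibly infinite
  derivation tree with finitely many distinct subtrees, and every such tree arises in this way.
  As on the side of CoLF, presentations with the same unfolding are identified.
\<close>

definition circular_derivations :: "'t osig \<Rightarrow> 't \<Rightarrow> 't deriv set" where
  "circular_derivations \<Omega> t = {d. derives \<Omega> d t \<and> finite (subderivs d)}"


section \<open>The encoding\<close>

datatype fam = postp | empty

datatype con = times | one | plus | zero | zero_emp | plus_emp | times_emp_1 | times_emp_2

text \<open>
  \<open>TName t\<close> is the recursion constant for the type name \<open>t\<close>; the names \<open>Aux n\<close> remain available for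
  further recursion constants.
\<close>

datatype 't rname = TName 't | Aux nat

type_synonym 't etm = "(con, 't rname) tm"
type_synonym 't ety = "(fam, con, 't rname) ty"

abbreviation capp :: "con \<Rightarrow> 't etm list \<Rightarrow> 't etm" where
  "capp c Ms \<equiv> App (Con c) (map Arg Ms)"

abbreviation postp_ty :: "'t ety" where
  "postp_ty \<equiv> Atom postp []"

abbreviation empty_ty :: "'t etm \<Rightarrow> 't ety" where
  "empty_ty M \<equiv> Atom empty [Arg M]"

abbreviation dbv :: "nat \<Rightarrow> 't etm" where
  "dbv i \<equiv> App (Var i) []"

abbreviation arrow :: "'t ety \<Rightarrow> 't ety \<Rightarrow> 't ety" (infixr \<open>\<rightarrow>\<^sub>o\<close> 60) where
  "A \<rightarrow>\<^sub>o B \<equiv> Pi Ord A (ren_ty Suc B)"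

text \<open>The implicit arguments \<open>T1\<close> and \<open>T2\<close>, here \<open>dbv 1\<close> and \<open>dbv 0\<close>, are made explicit.\<close>

abbreviation forall_T1_T2 :: "'t ety \<Rightarrow> 't ety" where
  "forall_T1_T2 A \<equiv> Pi Ord postp_ty (Pi Ord postp_ty A)"

definition base_sig :: "(fam, con, 't rname) lfsig" where
  "base_sig = [
     FamDecl postp Cotype,
     ConDecl times (postp_ty \<rightarrow>\<^sub>o postp_ty \<rightarrow>\<^sub>o postp_ty),
     ConDecl one postp_ty,
     ConDecl plus (postp_ty \<rightarrow>\<^sub>o postp_ty \<rightarrow>\<^sub>o postp_ty),
     ConDecl zero postp_ty,
     FamDecl empty (KPi Ord postp_ty Cotype),
     ConDecl zero_emp (empty_ty (capp zero [])),
     ConDecl plus_emp (forall_T1_T2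
       (empty_ty (dbv 1) \<rightarrow>\<^sub>o empty_ty (dbv 0) \<rightarrow>\<^sub>o empty_ty (capp plus [dbv 1, dbv 0]))),
     ConDecl times_emp_1 (forall_T1_T2
       (empty_ty (dbv 1) \<rightarrow>\<^sub>o empty_ty (capp times [dbv 1, dbv 0]))),
     ConDecl times_emp_2 (forall_T1_T2
       (empty_ty (dbv 0) \<rightarrow>\<^sub>o empty_ty (capp times [dbv 1, dbv 0])))]"

definition enc_name :: "'t \<Rightarrow> 't etm" where
  "enc_name t = App (Rec (TName t)) []"

fun enc_ptyp :: "'t ptyp \<Rightarrow> 't etm" where
  "enc_ptyp (TimesT t1 t2) = capp times [enc_name t1, enc_name t2]"
| "enc_ptyp OneT = capp one []"
| "enc_ptyp (PlusT t1 t2) = capp plus [enc_name t1, enc_name t2]"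
| "enc_ptyp ZeroT = capp zero []"

definition enc_sig :: "'t osig \<Rightarrow> (fam, con, 't rname) lfsig" where
  "enc_sig \<Omega> = base_sig @ map (\<lambda>(t, \<tau>). RecDecl (TName t) postp_ty (enc_ptyp \<tau>)) \<Omega>"

end

theory Submission
  imports Defs
begin

text \<open>
  A derivation and a Boehm tree correspond if they have the same shape, the tree additionally
  containing the unfoldings of the type names as implicit arguments. Since the definition of a type
  name is unique, this correspondence is functional in both directions. A derivation with finitely
  many subderivations becomes a term by introducing one recursion constant per subderivation.
  Conversely, a closed canonical term of type \<open>empty \<ulcorner>t\<urcorner>\<close> has only closed atomic arguments, so it is
  explored without ever applying a recursion constant; every term met on the way is a subterm of the
  initial term or of the body of a recursion constant, and together with the finitely many type
  names these determine finitely many subderivations.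
\<close>


section \<open>Hereditary substitution\<close>

text \<open>Distinct type names may unfold to the same tree, and definitional equality then
  identifies their encodings. A Boehm tree therefore does not determine the names in a derivation:
  the correspondence and the decoding carry the name of the conclusion along and recompute the names
  of the premises from the object signature. For the same reason the index of a well-typed term is
  known only up to unfolding, so inverting a typing needs injectivity of the type constructors
  modulo infinite unfolding. A second obstacle is that unfolding is a partial relation: a term may
  have no head normal form, so that even reflexivity of definitional equality amounts to an
  existence proof. No general normalization result is used; existence is shown only for sets of
  terms that are closed under the arguments of their head normal forms.\<close>

lemma hsub_Lam_iff: "hsub N k (Lam m M) R \<longleftrightarrow> (\<exists>M'. R = Lam m M' \<and> hsub (ren Suc N) (Suc k) M M')"
  by (subst hsub.simps) auto

lemma hsub_Var_iff:
  "hsub N k (App (Var i) S) R \<longleftrightarrow>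
     (\<exists>S'. hsubs N k S S' \<and>
        (if i = k then hred N S' R else R = App (Var (if i < k then i else i - 1)) S'))"
  by (subst hsub.simps) auto

lemma hsub_Con_iff: "hsub N k (App (Con c) S) R \<longleftrightarrow> (\<exists>S'. hsubs N k S S' \<and> R = App (Con c) S')"
  by (subst hsub.simps) auto

lemma hsub_Rec_iff: "hsub N k (App (Rec r) S) R \<longleftrightarrow> (\<exists>S'. hsubs N k S S' \<and> R = App (Rec r) S')"
  by (subst hsub.simps) auto

lemma hsubs_Nil_iff: "hsubs N k [] S' \<longleftrightarrow> S' = []"
  by (subst hsubs.simps) auto

lemma hsubs_Arg_iff:
  "hsubs N k (Arg M # S) R \<longleftrightarrow> (\<exists>M' S'. R = Arg M' # S' \<and> hsub N k M M' \<and> hsubs N k S S')"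
  by (subst hsubs.simps) auto

lemma hsubs_PArg_iff:
  "hsubs N k (PArg i # S) R \<longleftrightarrow>
     i \<noteq> k \<and> (\<exists>S'. R = PArg (if i < k then i else i - 1) # S' \<and> hsubs N k S S')"
  by (subst hsubs.simps) auto

lemma hred_App_iff: "hred (App h S) S' R \<longleftrightarrow> S' = [] \<and> R = App h S"
  by (subst hred.simps) auto

lemma hred_Lam_Ord_iff:
  "hred (Lam Ord M) S' R \<longleftrightarrow> (\<exists>N S M'. S' = Arg N # S \<and> hsub N 0 M M' \<and> hred M' S R)"
  by (subst hred.simps) auto

lemma hred_Lam_Pre_iff:
  "hred (Lam Pre M) S' R \<longleftrightarrow> (\<exists>x S. S' = PArg x # S \<and> hred (ren (inst x) M) S R)"
  by (subst hred.simps) auto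

text \<open>Each rule evaluates a relation on one known syntactic form, so that rewriting with them
  computes substitutions into concrete types.\<close>

lemmas hsub_iffs = hsub_Lam_iff hsub_Var_iff hsub_Con_iff hsub_Rec_iff
  hsubs_Nil_iff hsubs_Arg_iff hsubs_PArg_iff

lemmas hred_iffs = hred_App_iff hred_Lam_Ord_iff hred_Lam_Pre_iff

text \<open>The rules are syntax-directed, so simultaneous induction and inversion suffice. Only
  uniqueness of results is claimed, not their existence.\<close>

lemma hsub_hred_functional:
  shows "hsub N k M M1 \<Longrightarrow> hsub N k M M2 \<Longrightarrow> M1 = M2"
    and "hsubs N k S S1 \<Longrightarrow> hsubs N k S S2 \<Longrightarrow> S1 = S2"
    and "hred N S R1 \<Longrightarrow> hred N S R2 \<Longrightarrow> R1 = R2"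
proof (induction arbitrary: M2 and S2 and R2 rule: hsub_hsubs_hred.inducts)
  case (hsub_Lam N k M M' m)
  from hsub_Lam.prems hsub_Lam.IH show ?case unfolding hsub_Lam_iff by blast
next
  case (hsub_eq N k S S' R)
  from hsub_eq.prems hsub_eq.IH show ?case unfolding hsub_Var_iff by (metis (full_types))
next
  case (hsub_less i k N S S')
  from hsub_less.prems hsub_less.IH hsub_less.hyps show ?case
    unfolding hsub_Var_iff by (metis less_irrefl)
next
  case (hsub_greater k i N S S')
  from hsub_greater.prems hsub_greater.IH hsub_greater.hyps show ?case
    unfolding hsub_Var_iff by (metis less_irrefl less_asym)
next
  case (hsub_Con N k S S' c)
  from hsub_Con.prems hsub_Con.IH show ?case unfolding hsub_Con_iff by blast
next
  case (hsub_Rec N k S S' r)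
  from hsub_Rec.prems hsub_Rec.IH show ?case unfolding hsub_Rec_iff by blast
next
  case (hsubs_Nil N k)
  then show ?case by (simp add: hsubs_Nil_iff)
next
  case (hsubs_Arg N k M M' S S')
  from hsubs_Arg.prems hsubs_Arg.IH show ?case unfolding hsubs_Arg_iff by blast
next
  case (hsubs_PArg_less i k N S S')
  from hsubs_PArg_less.prems hsubs_PArg_less.IH hsubs_PArg_less.hyps show ?case
    unfolding hsubs_PArg_iff by (metis (full_types))
next
  case (hsubs_PArg_greater k i N S S')
  from hsubs_PArg_greater.prems hsubs_PArg_greater.IH hsubs_PArg_greater.hyps show ?case
    unfolding hsubs_PArg_iff by (metis less_asym)
next
  case (hred_Nil h S)
  then show ?case by (simp add: hred_App_iff)
next
  case (hred_Arg N M M' S R)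
  from hred_Arg.prems hred_Arg.IH show ?case unfolding hred_Lam_Ord_iff by blast
next
  case (hred_PArg x M S R)
  from hred_PArg.prems hred_PArg.IH show ?case unfolding hred_Lam_Pre_iff by blast
qed

lemma hsub_ty_Atom_iff: "hsub_ty N k (Atom a S) B \<longleftrightarrow> (\<exists>S'. B = Atom a S' \<and> hsubs N k S S')"
  by (subst hsub_ty.simps) auto

lemma hsub_ty_Pi_iff:
  "hsub_ty N k (Pi m A B) C \<longleftrightarrow>
     (\<exists>A' B'. C = Pi m A' B' \<and> hsub_ty N k A A' \<and> hsub_ty (ren Suc N) (Suc k) B B')"
  by (subst hsub_ty.simps) auto

lemma hsub_kd_Cotype_iff: "hsub_kd N k Cotype K \<longleftrightarrow> K = Cotype"
  by (subst hsub_kd.simps) auto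


section \<open>Definitional equality\<close>

text \<open>Extracts from distinctness of names what uniqueness of unfolding depends on. It is
  inherited by every signature with fewer declarations.\<close>

definition rec_functional :: "('a, 'c, 'r) lfsig \<Rightarrow> bool" where
  "rec_functional \<Sigma> \<longleftrightarrow> (\<forall>r A A' N N'. RecDecl r A N \<in> set \<Sigma> \<longrightarrow> RecDecl r A' N' \<in> set \<Sigma> \<longrightarrow>
     A = A' \<and> N = N')"

lemma rec_functional_if_distinct:
  assumes "distinct (map decl_name \<Sigma>)"
  shows "rec_functional \<Sigma>"
  unfolding rec_functional_def
proof (intro allI impI)
  fix r A A' N N'
  assume "RecDecl r A N \<in> set \<Sigma>" "RecDecl r A' N' \<in> set \<Sigma>"
  moreover have "inj_on decl_name (set \<Sigma>)" using assms by (simp add: distinct_map)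
  ultimately have "RecDecl r A N = RecDecl r A' N'" by (metis decl_name.simps(3) inj_onD)
  then show "A = A' \<and> N = N'" by simp
qed

lemma hnf_functional:
  assumes "rec_functional \<Sigma>"
  shows "hnf \<Sigma> M h S \<Longrightarrow> hnf \<Sigma> M h' S' \<Longrightarrow> h = h' \<and> S = S'"
proof (induction arbitrary: h' S' rule: hnf.induct)
  case (hnf_Rec r A N S R h S'')
  from hnf_Rec.prems obtain A' N' R' where
    "RecDecl r A' N' \<in> set \<Sigma>" "hred N' S R'" "hnf \<Sigma> R' h' S'"
    by cases auto
  moreover from this assms hnf_Rec.hyps have "N' = N" by (auto simp: rec_functional_def)
  ultimately show ?case using hnf_Rec hsub_hred_functional(3) by metis
qed (erule hnf.cases; simp)+

lemma unfolds_LamE: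
  assumes "unfolds \<Sigma> (Lam m M) T"
  obtains T' where "T = BLam m T'" "unfolds \<Sigma> M T'"
  using assms by cases (auto elim: hnf.cases)

lemma unfolds_AppE:
  assumes "unfolds \<Sigma> (App h S) T"
  obtains h' S' Ts where "T = BApp h' Ts" "hnf \<Sigma> (App h S) h' S'"
    "list_all2 (rel_arg (unfolds \<Sigma>)) S' Ts"
  using assms by cases auto

text \<open>Having a common source is a bisimulation on trees: the head normal form of the source is
  unique, so the roots agree and corresponding children again have a common source.\<close>

lemma unfolds_functional:
  assumes "rec_functional \<Sigma>" and "unfolds \<Sigma> M T1" and "unfolds \<Sigma> M T2"
  shows "T1 = T2"
proof -
  define X where "X = (\<lambda>T1 T2. \<exists>M. unfolds \<Sigma> M T1 \<and> unfolds \<Sigma> M T2)"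
  have args: "list_all2 (rel_arg X) Ts Us"
    if "list_all2 (rel_arg (unfolds \<Sigma>)) S Ts" "list_all2 (rel_arg (unfolds \<Sigma>)) S Us" for S Ts Us
    using that
  proof (induction S arbitrary: Ts Us)
    case (Cons a S)
    then show ?case
      by (cases a) (force simp: list_all2_Cons1 X_def elim: arg.rel_cases)+
  qed auto
  have "X T1 T2" using assms by (auto simp: X_def)
  then show ?thesis
  proof (coinduct rule: btree.coinduct_strong[consumes 1])
    case (Eq_btree T1 T2)
    then obtain M where M: "unfolds \<Sigma> M T1" "unfolds \<Sigma> M T2" by (auto simp: X_def)
    show ?case
    proof (cases M)
      case (Lam m M')
      with M show ?thesis by (auto simp: X_def elim!: unfolds_LamE)
    next
      case (App h S)
      from M[unfolded App] obtain h1 S1 Ts1 h2 S2 Ts2 where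
        T: "T1 = BApp h1 Ts1" "T2 = BApp h2 Ts2"
        and hnf: "hnf \<Sigma> (App h S) h1 S1" "hnf \<Sigma> (App h S) h2 S2"
        and all: "list_all2 (rel_arg (unfolds \<Sigma>)) S1 Ts1" "list_all2 (rel_arg (unfolds \<Sigma>)) S2 Ts2"
        by (elim unfolds_AppE) blast
      have "h1 = h2" "S1 = S2" using hnf_functional[OF assms(1) hnf] by auto
      with all args have "list_all2 (rel_arg X) Ts1 Ts2" by blast
      then have "list_all2 (rel_arg (\<lambda>T1 T2. X T1 T2 \<or> T1 = T2)) Ts1 Ts2"
        by (rule list.rel_mono_strong) (auto elim: arg.rel_mono_strong)
      with \<open>h1 = h2\<close> show ?thesis by (simp add: T)
    qed
  qed
qed

lemma hnf_mono:
  assumes "hnf \<Sigma> M h S" and "set \<Sigma> \<subseteq> set \<Sigma>'"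
  shows "hnf \<Sigma>' M h S"
  using assms by induction (auto intro: hnf.intros)

lemma unfolds_mono:
  assumes "unfolds \<Sigma> M T" and "set \<Sigma> \<subseteq> set \<Sigma>'"
  shows "unfolds \<Sigma>' M T"
  using assms(1)
proof (coinduct rule: unfolds.coinduct)
  case (unfolds M T)
  then show ?case
  proof cases
    case (unfolds_App h S Ts)
    have "list_all2 (rel_arg (\<lambda>M T. unfolds \<Sigma> M T \<or> unfolds \<Sigma>' M T)) S Ts"
      using unfolds_App(3) by (rule list.rel_mono_strong) (auto elim: arg.rel_mono_strong)
    with unfolds_App hnf_mono[OF _ assms(2)] show ?thesis by blast
  qed auto
qed

section \<open>Existence of unfoldings\<close>

text \<open>Corecursion needs total functions, so a head normal form is selected by choice; the
  value is arbitrary where there is none.\<close>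

definition whnf_head :: "('a, 'c, 'r) lfsig \<Rightarrow> ('c, 'r) tm \<Rightarrow> 'c bhead" where
  "whnf_head \<Sigma> M = fst (SOME p. hnf \<Sigma> M (fst p) (snd p))"

definition whnf_spine :: "('a, 'c, 'r) lfsig \<Rightarrow> ('c, 'r) tm \<Rightarrow> ('c, 'r) tm arg list" where
  "whnf_spine \<Sigma> M = snd (SOME p. hnf \<Sigma> M (fst p) (snd p))"

lemma hnf_whnf:
  assumes "hnf \<Sigma> M h S"
  shows "hnf \<Sigma> M (whnf_head \<Sigma> M) (whnf_spine \<Sigma> M)"
  unfolding whnf_head_def whnf_spine_def
  using assms someI[where P = "\<lambda>p. hnf \<Sigma> M (fst p) (snd p)" and x = "(h, S)"] by simp

text \<open>Produces no \<open>BLam\<close> nodes: it serves only for terms that have a head normal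
  form, and abstractions have none.\<close>

primcorec bohm :: "('a, 'c, 'r) lfsig \<Rightarrow> ('c, 'r) tm \<Rightarrow> 'c btree" where
  "bohm \<Sigma> M = BApp (whnf_head \<Sigma> M) (map (map_arg (bohm \<Sigma>)) (whnf_spine \<Sigma> M))"

text \<open>The set \<open>X\<close> is an invariant: its terms never get stuck, and their ordinary
  arguments stay inside. Prepattern arguments are variables and unfold to themselves.\<close>

lemma unfolds_exists:
  assumes "rec_functional \<Sigma>" and "M \<in> X"
    and step: "\<And>M. M \<in> X \<Longrightarrow> \<exists>h S. hnf \<Sigma> M h S \<and> (\<forall>N. Arg N \<in> set S \<longrightarrow> N \<in> X)"
  shows "\<exists>T. unfolds \<Sigma> M T"
proof -
  have "\<exists>M'\<in>X. M = M' \<and> bohm \<Sigma> M = bohm \<Sigma> M'" using assms by auto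
  then have "unfolds \<Sigma> M (bohm \<Sigma> M)"
  proof (coinduct rule: unfolds.coinduct)
    case (unfolds M T)
    then have M: "M \<in> X" "T = bohm \<Sigma> M" by auto
    from step[OF M(1)] obtain h S where
      hS: "hnf \<Sigma> M h S" "\<And>N. Arg N \<in> set S \<Longrightarrow> N \<in> X" by blast
    from hnf_functional[OF assms(1) hS(1) hnf_whnf[OF hS(1)]]
    have T: "T = BApp h (map (map_arg (bohm \<Sigma>)) S)" using M(2) by (simp add: bohm.code)
    have "list_all2 (rel_arg (\<lambda>M T. (\<exists>M'\<in>X. M = M' \<and> T = bohm \<Sigma> M') \<or> unfolds \<Sigma> M T)) S
        (map (map_arg (bohm \<Sigma>)) S)"
      unfolding list_all2_map2
    proof (rule list.rel_refl_strong)
      fix a assume "a \<in> set S"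
      with hS(2) show "rel_arg (\<lambda>M T. (\<exists>M'\<in>X. M = M' \<and> T = bohm \<Sigma> M') \<or> unfolds \<Sigma> M T) a
        (map_arg (bohm \<Sigma>) a)" by (cases a) auto
    qed
    with hS(1) T show ?case by blast
  qed
  then show ?thesis ..
qed

section \<open>Transitivity of definitional equality\<close>

text \<open>The two common trees coincide because both are unfoldings of the middle term.\<close>

lemma tm_eq_trans:
  assumes "rec_functional \<Sigma>" "tm_eq \<Sigma> M N" "tm_eq \<Sigma> N P"
  shows "tm_eq \<Sigma> M P"
  using assms unfolds_functional unfolding tm_eq_def by metis

lemma ty_eq_Atom_iff:
  "ty_eq \<Sigma> (Atom a S) B \<longleftrightarrow> (\<exists>S'. B = Atom a S' \<and> list_all2 (rel_arg (tm_eq \<Sigma>)) S S')"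
  by (subst ty_eq.simps) auto

lemma ty_eq_Pi_iff:
  "ty_eq \<Sigma> (Pi m A B) C \<longleftrightarrow> (\<exists>A' B'. C = Pi m A' B' \<and> ty_eq \<Sigma> A A' \<and> ty_eq \<Sigma> B B')"
  by (subst ty_eq.simps) auto

lemma rel_arg_trans:
  assumes "\<And>x y z. R x y \<Longrightarrow> R y z \<Longrightarrow> R x z" "rel_arg R a b" "rel_arg R b c"
  shows "rel_arg R a c"
  using assms by (cases a; cases b; cases c) auto

lemma ty_eq_trans:
  assumes "rec_functional \<Sigma>"
  shows "ty_eq \<Sigma> A B \<Longrightarrow> ty_eq \<Sigma> B C \<Longrightarrow> ty_eq \<Sigma> A C"
proof (induction arbitrary: C rule: ty_eq.induct)
  case (1 S S' a)
  then show ?case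
    using list_all2_trans[of "rel_arg (tm_eq \<Sigma>)" "rel_arg (tm_eq \<Sigma>)" "rel_arg (tm_eq \<Sigma>)"]
      rel_arg_trans[of "tm_eq \<Sigma>", OF tm_eq_trans[OF assms]]
    by (fastforce simp: ty_eq_Atom_iff)
qed (auto simp: ty_eq_Pi_iff)


section \<open>Closed terms\<close>

text \<open>Terms typed in the empty context are closed, and renaming and substitution fix closed
  terms. This makes the dependent types of the constructors computable without a general theory of
  substitution.\<close>

inductive scoped :: "nat \<Rightarrow> ('c, 'r) tm \<Rightarrow> bool" where
  scoped_Lam: "scoped (Suc n) M \<Longrightarrow> scoped n (Lam m M)"
| scoped_App: "(\<And>i. h = Var i \<Longrightarrow> i < n) \<Longrightarrow> (\<And>M. Arg M \<in> set S \<Longrightarrow> scoped n M) \<Longrightarrow>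
    (\<And>i. PArg i \<in> set S \<Longrightarrow> i < n) \<Longrightarrow> scoped n (App h S)"

lemma typed_scoped:
  shows "chk \<Sigma> \<Gamma> M A \<Longrightarrow> scoped (length \<Gamma>) M"
    and "syn \<Sigma> \<Gamma> R P \<Longrightarrow> scoped (length \<Gamma>) R"
    and "spn \<Sigma> \<Gamma> S A P \<Longrightarrow>
      (\<forall>M. Arg M \<in> set S \<longrightarrow> scoped (length \<Gamma>) M) \<and> (\<forall>i. PArg i \<in> set S \<longrightarrow> i < length \<Gamma>)"
  by (induction rule: chk_syn_spn.inducts) (auto intro!: scoped.intros simp: lookup_def)

lemma ren_scoped:
  assumes "scoped n M" "\<And>i. i < n \<Longrightarrow> f i = i"
  shows "ren f M = M"
  using assms
proof (induction arbitrary: f)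
  case (scoped_Lam n M m)
  have "up f i = i" if "i < Suc n" for i using that scoped_Lam.prems by (cases i) auto
  with scoped_Lam show ?case by simp
next
  case (scoped_App h n S)
  have "ren_head f h = h" using scoped_App by (cases h) auto
  moreover have "map (ren_arg f) S = S"
  proof (rule map_idI)
    fix a assume "a \<in> set S"
    with scoped_App show "ren_arg f a = a" by (cases a) auto
  qed
  ultimately show ?case by simp
qed

lemma hsubs_refl:
  assumes "\<And>M. Arg M \<in> set S \<Longrightarrow> hsub N k M M" "\<And>i. PArg i \<in> set S \<Longrightarrow> i < k"
  shows "hsubs N k S S"
  using assms
proof (induction S)
  case (Cons a S)
  then show ?case by (cases a) (auto simp: hsub_iffs)
qed (simp add: hsub_iffs)

text \<open>All free indices lie below \<open>k\<close>, so none is replaced and none is lowered.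
  The bound \<open>n \<le> k\<close> generalizes closedness because a binder raises both
  numbers.\<close>

lemma hsub_scoped:
  assumes "scoped n M" "n \<le> k"
  shows "hsub N k M M"
  using assms
proof (induction arbitrary: N k)
  case (scoped_App h n S)
  then have "hsubs N k S S" by (intro hsubs_refl) (auto intro: less_le_trans)
  with scoped_App show ?case by (cases h) (force simp: hsub_iffs)+
qed (auto intro: hsub_Lam)

lemma ren_closed: "scoped 0 M \<Longrightarrow> ren f M = M"
  by (auto intro: ren_scoped)

lemma hsub_closed_iff: "scoped 0 M \<Longrightarrow> hsub N k M R \<longleftrightarrow> R = M"
  using hsub_scoped hsub_hred_functional(1) by blast


section \<open>Inversion of typing\<close>

lemma chk_Atom_iff:
  "chk \<Sigma> \<Gamma> M (Atom a S') \<longleftrightarrow>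
     (\<exists>h S P. M = App h S \<and> syn \<Sigma> \<Gamma> M P \<and> ty_eq \<Sigma> P (Atom a S'))"
  by (subst chk.simps) auto

lemma syn_Var_iff:
  "syn \<Sigma> \<Gamma> (App (Var i) S) P \<longleftrightarrow> (\<exists>m A. lookup \<Gamma> i m A \<and> spn \<Sigma> \<Gamma> S A P)"
  by (subst syn.simps) auto

lemma syn_Con_iff:
  "syn \<Sigma> \<Gamma> (App (Con c) S) P \<longleftrightarrow> (\<exists>A. ConDecl c A \<in> set \<Sigma> \<and> spn \<Sigma> \<Gamma> S A P)"
  by (subst syn.simps) auto

lemma syn_Rec_iff:
  "syn \<Sigma> \<Gamma> (App (Rec r) S) P \<longleftrightarrow> (\<exists>A N. RecDecl r A N \<in> set \<Sigma> \<and> spn \<Sigma> \<Gamma> S A P)"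
  by (subst syn.simps) auto

lemma spn_Atom_iff: "spn \<Sigma> \<Gamma> S (Atom a S') P \<longleftrightarrow> S = [] \<and> P = Atom a S'"
  by (subst spn.simps) auto

lemma spn_Pi_Ord_iff:
  "spn \<Sigma> \<Gamma> S (Pi Ord A B) P \<longleftrightarrow>
     (\<exists>M S' B'. S = Arg M # S' \<and> chk \<Sigma> \<Gamma> M A \<and> hsub_ty M 0 B B' \<and> spn \<Sigma> \<Gamma> S' B' P)"
  by (subst spn.simps) auto

lemma kspn_Cotype_iff: "kspn \<Sigma> \<Gamma> S Cotype \<longleftrightarrow> S = []"
  by (subst kspn.simps) auto

lemma kspn_KPi_Ord_iff:
  "kspn \<Sigma> \<Gamma> S (KPi Ord A K) \<longleftrightarrow>
     (\<exists>M S' K'. S = Arg M # S' \<and> chk \<Sigma> \<Gamma> M A \<and> hsub_kd M 0 K K' \<and> kspn \<Sigma> \<Gamma> S' K')"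
  by (subst kspn.simps) auto

lemma wf_ty_Atom_iff: "wf_ty \<Sigma> \<Gamma> (Atom a S) \<longleftrightarrow> (\<exists>K. FamDecl a K \<in> set \<Sigma> \<and> kspn \<Sigma> \<Gamma> S K)"
  by (subst wf_ty.simps) auto

lemma wf_ty_Pi_iff: "wf_ty \<Sigma> \<Gamma> (Pi m A B) \<longleftrightarrow> wf_ty \<Sigma> \<Gamma> A \<and> wf_ty \<Sigma> ((m, A) # \<Gamma>) B"
  by (subst wf_ty.simps) auto

lemma wf_kd_Cotype: "wf_kd \<Sigma> \<Gamma> Cotype"
  by (rule wf_kd.intros)

lemma wf_kd_KPi_iff: "wf_kd \<Sigma> \<Gamma> (KPi m A K) \<longleftrightarrow> wf_ty \<Sigma> \<Gamma> A \<and> wf_kd \<Sigma> ((m, A) # \<Gamma>) K"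
  by (subst wf_kd.simps) auto

section \<open>Terms reachable from a closed term\<close>

text \<open>Abstractions are not entered: what lies below a binder need not be closed, and the
  exploration of closed atomic terms does not go there.\<close>

primrec subtms :: "('c, 'r) tm \<Rightarrow> ('c, 'r) tm set" where
  "subtms (Lam m M) = {Lam m M}"
| "subtms (App h S) = insert (App h S) (\<Union> (\<Union> (set_arg ` set (map (map_arg subtms) S))))"

lemma self_in_subtms: "M \<in> subtms M"
  by (cases M) auto

lemma finite_subtms: "finite (subtms M)"
  by (induction M) (auto simp: arg.set_map)

lemma arg_in_subtms: "App h S \<in> subtms M \<Longrightarrow> Arg N \<in> set S \<Longrightarrow> N \<in> subtms M"
proof (induction M)
  case (App h' S')
  show ?case
  proof (cases "App h S = App h' S'")
    case True
    with App.prems have "Arg N \<in> set S'" by simp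
    then show ?thesis using self_in_subtms[of N] by (force simp: arg.set_map)
  next
    case False
    with App.prems obtain a M where "a \<in> set S'" "M \<in> set_arg a" "App h S \<in> subtms M"
      by (auto simp: arg.set_map)
    with App show ?thesis by (force simp: arg.set_map)
  qed
qed auto

text \<open>The finite state space of the exploration. It contains all bodies and is closed under
  arguments, so replacing an unapplied recursion constant by its body and passing to an argument of
  that body stays inside.\<close>

definition reach :: "('a, 'c, 'r) lfsig \<Rightarrow> ('c, 'r) tm \<Rightarrow> ('c, 'r) tm set" where
  "reach \<Sigma> M = subtms M \<union> \<Union> {subtms N |r A N. RecDecl r A N \<in> set \<Sigma>}"

lemma finite_reach: "finite (reach \<Sigma> M)"
proof -
  have "{subtms N |r A N. RecDecl r A N \<in> set \<Sigma>} \<subseteq>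
      (\<lambda>d. case d of RecDecl r A N \<Rightarrow> subtms N | _ \<Rightarrow> {}) ` set \<Sigma>"
    by (force simp: image_iff)
  then have "finite {subtms N |r A N. RecDecl r A N \<in> set \<Sigma>}" by (rule finite_subset) simp
  then show ?thesis by (auto simp: reach_def finite_subtms)
qed

lemma reach_arg: "App h S \<in> reach \<Sigma> M \<Longrightarrow> Arg N \<in> set S \<Longrightarrow> N \<in> reach \<Sigma> M"
  unfolding reach_def using arg_in_subtms by blast

lemma reach_rec: "RecDecl r A N \<in> set \<Sigma> \<Longrightarrow> N \<in> reach \<Sigma> M"
  unfolding reach_def using self_in_subtms by blast

text \<open>
  In the empty context there are no prepattern variables, so a recursion constant can only occur
  unapplied there, and by contractiveness its definition starts with a constructor.
\<close>

lemma chk_Nil_AtomE: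
  assumes wf: "wf_sig \<Sigma>" and chk: "chk \<Sigma> [] M (Atom a S')"
  obtains c S A P where
    "\<And>N M'. M \<in> reach \<Sigma> M' \<Longrightarrow> Arg N \<in> set S \<Longrightarrow> N \<in> reach \<Sigma> M'"
    "hnf \<Sigma> M (BCon c) S" "ConDecl c A \<in> set \<Sigma>" "spn \<Sigma> [] S A P" "ty_eq \<Sigma> P (Atom a S')"
proof -
  have fn: "rec_functional \<Sigma>" using wf by (simp add: wf_sig_def rec_functional_if_distinct)
  from chk obtain h S P where M: "M = App h S" "syn \<Sigma> [] (App h S) P" "ty_eq \<Sigma> P (Atom a S')"
    by (auto simp: chk_Atom_iff)
  show ?thesis
  proof (cases h)
    case (Var i)
    with M show ?thesis by (auto simp: syn_Var_iff lookup_def)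
  next
    case (Con c)
    with M obtain A where "ConDecl c A \<in> set \<Sigma>" "spn \<Sigma> [] S A P" by (auto simp: syn_Con_iff)
    moreover have "N \<in> reach \<Sigma> M'" if "M \<in> reach \<Sigma> M'" "Arg N \<in> set S" for N M'
      using that reach_arg M(1) by blast
    moreover have "hnf \<Sigma> M (BCon c) S" unfolding M Con by (rule hnf_Con)
    ultimately show ?thesis using that M(3) by blast
  next
    case (Rec r)
    with M obtain A N where A: "RecDecl r A N \<in> set \<Sigma>" "spn \<Sigma> [] S A P" by (auto simp: syn_Rec_iff)
    with wf have N: "prepattern A" "chk \<Sigma> [] N A" "contractive N" by (auto simp: wf_sig_def)
    from A(2) N(1) obtain b S1 where At: "A = Atom b S1" "S = []" "P = Atom b S1"
      by cases (auto simp: lookup_def)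
    from N(2) At obtain h' S2 P' where
      N': "N = App h' S2" "syn \<Sigma> [] (App h' S2) P'" "ty_eq \<Sigma> P' (Atom b S1)"
      by (auto simp: chk_Atom_iff)
    from N(3) N' obtain c where c: "h' = Con c"
      by (cases h') (auto simp: syn_Var_iff lookup_def)
    with N' obtain A' where A': "ConDecl c A' \<in> set \<Sigma>" "spn \<Sigma> [] S2 A' P'"
      by (auto simp: syn_Con_iff)
    have "hnf \<Sigma> M (BCon c) S2"
      unfolding M Rec At using A(1) N' c by (auto intro!: hnf.intros simp: hred_iffs)
    \<comment> \<open>The type synthesized for the body equals the declared type of
      \<open>r\<close>, which equals the required type.\<close>
    moreover have "ty_eq \<Sigma> P' (Atom a S')" using ty_eq_trans[OF fn] N'(3) M(3) At by blast
    moreover have "N1 \<in> reach \<Sigma> M'" if "Arg N1 \<in> set S2" for N1 M'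
      using that reach_arg reach_rec[OF A(1)] N'(1) by blast
    ultimately show ?thesis using that A' by blast
  qed
qed


section \<open>Typing in extensions of the encoded signature\<close>

text \<open>Atomicity matters when substituting into \<open>dbv i\<close>: on the empty spine
  \<open>hred\<close> returns its first argument only if that is not an abstraction.\<close>

definition closed_atomic :: "('c, 'r) tm \<Rightarrow> bool" where
  "closed_atomic M \<longleftrightarrow> scoped 0 M \<and> (\<exists>h S. M = App h S)"

lemma closed_atomic_if_chk: "chk \<Sigma> [] M (Atom a S) \<Longrightarrow> closed_atomic M"
  unfolding closed_atomic_def
  using typed_scoped(1)[of \<Sigma> "[]" M "Atom a S"] chk_Atom_iff[of \<Sigma> "[]" M a S] by auto

lemma closed_atomic_ren: "closed_atomic M \<Longrightarrow> ren f M = M"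
  by (simp add: closed_atomic_def ren_closed)

lemma closed_atomic_hsub_iff: "closed_atomic M \<Longrightarrow> hsub N k M R \<longleftrightarrow> R = M"
  by (simp add: closed_atomic_def hsub_closed_iff)

lemma closed_atomic_hred_iff: "closed_atomic M \<Longrightarrow> hred M [] R \<longleftrightarrow> R = M"
  by (auto simp: closed_atomic_def hred_iffs)

lemmas closed_atomic_simps =
  closed_atomic_ren closed_atomic_hsub_iff closed_atomic_hred_iff

lemma hsub_ty_postp_iff: "hsub_ty N k postp_ty B \<longleftrightarrow> B = postp_ty"
  by (simp add: hsub_ty_Atom_iff hsubs_Nil_iff)

text \<open>\<open>F\<close> and \<open>G\<close> are the types left after instantiating the first
  and then the second implicit argument; each constructor supplies its own. The shift of
  \<open>M1\<close> under the second binder disappears because \<open>M1\<close> is closed.\<close>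

lemma spn_forall_T1_T2_iff:
  assumes F: "\<And>M1 B. closed_atomic M1 \<Longrightarrow> hsub_ty M1 1 A B \<longleftrightarrow> B = F M1"
    and G: "\<And>M1 M2 C. closed_atomic M1 \<Longrightarrow> closed_atomic M2 \<Longrightarrow>
      hsub_ty M2 0 (F M1) C \<longleftrightarrow> C = G M1 M2"
  shows "spn \<Sigma> [] S (forall_T1_T2 A) P \<longleftrightarrow>
     (\<exists>M1 M2 S'. S = Arg M1 # Arg M2 # S' \<and> chk \<Sigma> [] M1 postp_ty \<and> chk \<Sigma> [] M2 postp_ty \<and>
        spn \<Sigma> [] S' (G M1 M2) P)" (is "?L \<longleftrightarrow> ?R")
proof
  assume ?L
  then obtain M1 S1 B where "S = Arg M1 # S1" "chk \<Sigma> [] M1 postp_ty"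
    "hsub_ty (ren Suc M1) (Suc 0) A B" "spn \<Sigma> [] S1 (Pi Ord postp_ty B) P"
    by (auto simp only: spn_Pi_Ord_iff[of _ _ S] hsub_ty_Pi_iff hsub_ty_postp_iff)
  moreover from this(4) obtain M2 S' C where "S1 = Arg M2 # S'" "chk \<Sigma> [] M2 postp_ty"
    "hsub_ty M2 0 B C" "spn \<Sigma> [] S' C P"
    by (auto simp only: spn_Pi_Ord_iff[of _ _ S1])
  ultimately have 1: "S = Arg M1 # Arg M2 # S'" "chk \<Sigma> [] M1 postp_ty"
    "chk \<Sigma> [] M2 postp_ty" "hsub_ty (ren Suc M1) (Suc 0) A B" "hsub_ty M2 0 B C" "spn \<Sigma> [] S' C P"
    by simp_all
  have cl: "closed_atomic M1" "closed_atomic M2" using 1(2,3)[THEN closed_atomic_if_chk] by simp_all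
  have "B = F M1" using 1(4) F[OF cl(1), of B] by (simp add: closed_atomic_ren[OF cl(1)])
  moreover from this have "C = G M1 M2" using 1(5) G[OF cl, of C] by simp
  ultimately show ?R using 1 by blast
next
  assume ?R
  then obtain M1 M2 S' where 1: "S = Arg M1 # Arg M2 # S'" "chk \<Sigma> [] M1 postp_ty"
    "chk \<Sigma> [] M2 postp_ty" "spn \<Sigma> [] S' (G M1 M2) P"
    by blast
  have cl: "closed_atomic M1" "closed_atomic M2" using 1(2,3)[THEN closed_atomic_if_chk] by simp_all
  have "hsub_ty M1 0 (Pi Ord postp_ty A) (Pi Ord postp_ty (F M1))"
    unfolding hsub_ty_Pi_iff hsub_ty_postp_iff closed_atomic_ren[OF cl(1)]
    using F[OF cl(1), of "F M1"] by simp
  moreover have "spn \<Sigma> [] (Arg M2 # S') (Pi Ord postp_ty (F M1)) P"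
    using spn_Arg[OF 1(3) _ 1(4)] G[OF cl, of "G M1 M2"] by simp
  ultimately show ?L unfolding 1(1) by (rule spn_Arg[OF 1(2)])
qed

lemma spn_plus_emp_iff:
  "spn \<Sigma> [] S (forall_T1_T2
      (empty_ty (dbv 1) \<rightarrow>\<^sub>o empty_ty (dbv 0) \<rightarrow>\<^sub>o empty_ty (capp plus [dbv 1, dbv 0]))) P \<longleftrightarrow>
    (\<exists>M1 M2 D1 D2. S = [Arg M1, Arg M2, Arg D1, Arg D2] \<and>
      chk \<Sigma> [] M1 postp_ty \<and> chk \<Sigma> [] M2 postp_ty \<and>
      chk \<Sigma> [] D1 (empty_ty M1) \<and> chk \<Sigma> [] D2 (empty_ty M2) \<and> P = empty_ty (capp plus [M1, M2]))"
proof -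
  \<comment> \<open>Once both indices are closed terms, the remaining products do not depend on
    their variables, so instantiating them changes nothing.\<close>
  have "spn \<Sigma> [] S' (Pi Ord (empty_ty M1) (Pi Ord (empty_ty M2) (empty_ty (capp plus [M1, M2])))) P \<longleftrightarrow>
      (\<exists>D1 D2. S' = [Arg D1, Arg D2] \<and> chk \<Sigma> [] D1 (empty_ty M1) \<and> chk \<Sigma> [] D2 (empty_ty M2) \<and>
        P = empty_ty (capp plus [M1, M2]))"
    if "chk \<Sigma> [] M1 postp_ty" "chk \<Sigma> [] M2 postp_ty" for M1 M2 S'
    using that[THEN closed_atomic_if_chk]
    by (auto simp: spn_Pi_Ord_iff hsub_ty_Pi_iff hsub_ty_Atom_iff hsub_Con_iff hsubs_Nil_iff
        hsubs_Arg_iff closed_atomic_simps spn_Atom_iff)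
  then show ?thesis
    by (subst spn_forall_T1_T2_iff[where
        F = "\<lambda>M1. empty_ty M1 \<rightarrow>\<^sub>o empty_ty (dbv 0) \<rightarrow>\<^sub>o empty_ty (capp plus [M1, dbv 0])" and
        G = "\<lambda>M1 M2. Pi Ord (empty_ty M1) (Pi Ord (empty_ty M2) (empty_ty (capp plus [M1, M2])))"])
      (simp add: hsub_ty_Pi_iff hsub_ty_Atom_iff hsub_Con_iff hsub_Var_iff hsubs_Nil_iff
        hsubs_Arg_iff closed_atomic_simps, simp add: hsub_ty_Pi_iff hsub_ty_Atom_iff hsub_Con_iff
        hsub_Var_iff hsubs_Nil_iff hsubs_Arg_iff closed_atomic_simps, blast)
qed

lemma spn_times_emp_1_iff:
  "spn \<Sigma> [] S (forall_T1_T2 (empty_ty (dbv 1) \<rightarrow>\<^sub>o empty_ty (capp times [dbv 1, dbv 0]))) P \<longleftrightarrow>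
    (\<exists>M1 M2 D. S = [Arg M1, Arg M2, Arg D] \<and> chk \<Sigma> [] M1 postp_ty \<and> chk \<Sigma> [] M2 postp_ty \<and>
      chk \<Sigma> [] D (empty_ty M1) \<and> P = empty_ty (capp times [M1, M2]))"
proof -
  have "spn \<Sigma> [] S' (Pi Ord (empty_ty M1) (empty_ty (capp times [M1, M2]))) P \<longleftrightarrow>
      (\<exists>D. S' = [Arg D] \<and> chk \<Sigma> [] D (empty_ty M1) \<and> P = empty_ty (capp times [M1, M2]))"
    if "chk \<Sigma> [] M1 postp_ty" "chk \<Sigma> [] M2 postp_ty" for M1 M2 S'
    using that[THEN closed_atomic_if_chk]
    by (auto simp: spn_Pi_Ord_iff hsub_ty_Pi_iff hsub_ty_Atom_iff hsub_Con_iff hsubs_Nil_iff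
        hsubs_Arg_iff closed_atomic_simps spn_Atom_iff)
  then show ?thesis
    by (subst spn_forall_T1_T2_iff[where
        F = "\<lambda>M1. empty_ty M1 \<rightarrow>\<^sub>o empty_ty (capp times [M1, dbv 0])" and
        G = "\<lambda>M1 M2. Pi Ord (empty_ty M1) (empty_ty (capp times [M1, M2]))"])
      (simp add: hsub_ty_Pi_iff hsub_ty_Atom_iff hsub_Con_iff hsub_Var_iff hsubs_Nil_iff
        hsubs_Arg_iff closed_atomic_simps, simp add: hsub_ty_Pi_iff hsub_ty_Atom_iff hsub_Con_iff
        hsub_Var_iff hsubs_Nil_iff hsubs_Arg_iff closed_atomic_simps, blast)
qed

lemma spn_times_emp_2_iff:
  "spn \<Sigma> [] S (forall_T1_T2 (empty_ty (dbv 0) \<rightarrow>\<^sub>o empty_ty (capp times [dbv 1, dbv 0]))) P \<longleftrightarrow>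
    (\<exists>M1 M2 D. S = [Arg M1, Arg M2, Arg D] \<and> chk \<Sigma> [] M1 postp_ty \<and> chk \<Sigma> [] M2 postp_ty \<and>
      chk \<Sigma> [] D (empty_ty M2) \<and> P = empty_ty (capp times [M1, M2]))"
proof -
  have "spn \<Sigma> [] S' (Pi Ord (empty_ty M2) (empty_ty (capp times [M1, M2]))) P \<longleftrightarrow>
      (\<exists>D. S' = [Arg D] \<and> chk \<Sigma> [] D (empty_ty M2) \<and> P = empty_ty (capp times [M1, M2]))"
    if "chk \<Sigma> [] M1 postp_ty" "chk \<Sigma> [] M2 postp_ty" for M1 M2 S'
    using that[THEN closed_atomic_if_chk]
    by (auto simp: spn_Pi_Ord_iff hsub_ty_Pi_iff hsub_ty_Atom_iff hsub_Con_iff hsubs_Nil_iff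
        hsubs_Arg_iff closed_atomic_simps spn_Atom_iff)
  then show ?thesis
    by (subst spn_forall_T1_T2_iff[where
        F = "\<lambda>M1. empty_ty (dbv 0) \<rightarrow>\<^sub>o empty_ty (capp times [M1, dbv 0])" and
        G = "\<lambda>M1 M2. Pi Ord (empty_ty M2) (empty_ty (capp times [M1, M2]))"])
      (simp add: hsub_ty_Pi_iff hsub_ty_Atom_iff hsub_Con_iff hsub_Var_iff hsubs_Nil_iff
        hsubs_Arg_iff closed_atomic_simps, simp add: hsub_ty_Pi_iff hsub_ty_Atom_iff hsub_Con_iff
        hsub_Var_iff hsubs_Nil_iff hsubs_Arg_iff closed_atomic_simps, blast)
qed

section \<open>Well-formedness of the base signature\<close>

lemma ty_eq_postp: "ty_eq \<Sigma> postp_ty postp_ty"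
  by (simp add: ty_eq_Atom_iff)

lemma chk_postp_Var: "lookup \<Gamma> i m postp_ty \<Longrightarrow> chk \<Sigma> \<Gamma> (dbv i) postp_ty"
  using ty_eq_postp unfolding chk_Atom_iff syn_Var_iff by (blast intro: spn_Nil)

lemma chk_postp_Con0:
  "ConDecl c postp_ty \<in> set \<Sigma> \<Longrightarrow> chk \<Sigma> \<Gamma> (App (Con c) []) postp_ty"
  using ty_eq_postp unfolding chk_Atom_iff syn_Con_iff by (blast intro: spn_Nil)

lemma chk_postp_Con2:
  assumes "ConDecl c (postp_ty \<rightarrow>\<^sub>o postp_ty \<rightarrow>\<^sub>o postp_ty) \<in> set \<Sigma>"
    "chk \<Sigma> \<Gamma> M postp_ty" "chk \<Sigma> \<Gamma> N postp_ty"
  shows "chk \<Sigma> \<Gamma> (App (Con c) [Arg M, Arg N]) postp_ty"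
proof -
  have "spn \<Sigma> \<Gamma> [Arg M, Arg N] (postp_ty \<rightarrow>\<^sub>o postp_ty \<rightarrow>\<^sub>o postp_ty) postp_ty"
    using assms by (simp add: spn_Pi_Ord_iff hsub_ty_Pi_iff hsub_ty_Atom_iff hsub_iffs spn_Atom_iff)
  with assms(1) show ?thesis unfolding chk_Atom_iff syn_Con_iff using ty_eq_postp by blast
qed

lemma wf_ty_empty:
  assumes "set base_sig \<subseteq> set \<Sigma>" "chk \<Sigma> \<Gamma> M postp_ty"
  shows "wf_ty \<Sigma> \<Gamma> (empty_ty M)"
  using assms
  by (auto simp: wf_ty_Atom_iff kspn_Cotype_iff kspn_KPi_Ord_iff hsub_kd_Cotype_iff base_sig_def
      intro!: exI[of _ "KPi Ord postp_ty Cotype"])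

text \<open>Stated for every larger signature, since declarations are checked against the whole
  signature, including auxiliary recursion constants added later.\<close>

lemma wf_decl_base_sig:
  assumes base: "set base_sig \<subseteq> set \<Sigma>" and d: "d \<in> set base_sig"
  shows "wf_decl \<Sigma> d"
proof -
  have post: "wf_ty \<Sigma> \<Gamma> postp_ty" for \<Gamma>
    using base by (auto simp: wf_ty_Atom_iff kspn_Cotype_iff base_sig_def intro!: exI[of _ Cotype])
  have con: "ConDecl times (postp_ty \<rightarrow>\<^sub>o postp_ty \<rightarrow>\<^sub>o postp_ty) \<in> set \<Sigma>"
    "ConDecl plus (postp_ty \<rightarrow>\<^sub>o postp_ty \<rightarrow>\<^sub>o postp_ty) \<in> set \<Sigma>"
    "ConDecl zero postp_ty \<in> set \<Sigma>"
    using base by (auto simp: base_sig_def)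
  show ?thesis
    using d con unfolding base_sig_def
    by (auto simp: wf_ty_Pi_iff wf_kd_KPi_iff wf_kd_Cotype lookup_def
        intro!: post wf_ty_empty[OF base] chk_postp_Var chk_postp_Con0 chk_postp_Con2)
qed

lemma enc_sig_decls:
  "FamDecl a K \<in> set (enc_sig \<Omega>) \<longleftrightarrow> FamDecl a K \<in> set base_sig"
  "ConDecl c A \<in> set (enc_sig \<Omega>) \<longleftrightarrow> ConDecl c A \<in> set base_sig"
  "RecDecl r A N \<in> set (enc_sig \<Omega>) \<longleftrightarrow>
     (\<exists>t \<tau>. (t, \<tau>) \<in> set \<Omega> \<and> r = TName t \<and> A = postp_ty \<and> N = enc_ptyp \<tau>)"
  by (auto simp: enc_sig_def base_sig_def image_iff split_beta) force+

lemma set_base_sig_subset: "set base_sig \<subseteq> set (enc_sig \<Omega>)"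
  by (auto simp: enc_sig_def)

text \<open>The constructors of object types share one case: their result type
  \<open>postp_ty\<close> already rules them out as heads of terms of an \<open>empty\<close>
  type.\<close>

lemma base_sig_ConDecl:
  assumes "ConDecl c A \<in> set base_sig" "spn \<Sigma> [] S A P"
  obtains "c \<in> {times, one, plus, zero}" "P = postp_ty"
  | "c = zero_emp" "S = []" "P = empty_ty (capp zero [])"
  | M1 M2 D1 D2 where "c = plus_emp" "S = [Arg M1, Arg M2, Arg D1, Arg D2]"
      "chk \<Sigma> [] D1 (empty_ty M1)" "chk \<Sigma> [] D2 (empty_ty M2)" "P = empty_ty (capp plus [M1, M2])"
  | M1 M2 D where "c = times_emp_1" "S = [Arg M1, Arg M2, Arg D]"
      "chk \<Sigma> [] D (empty_ty M1)" "P = empty_ty (capp times [M1, M2])"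
  | M1 M2 D where "c = times_emp_2" "S = [Arg M1, Arg M2, Arg D]"
      "chk \<Sigma> [] D (empty_ty M2)" "P = empty_ty (capp times [M1, M2])"
proof -
  have arrows: "P = postp_ty" if "spn \<Sigma> [] S (postp_ty \<rightarrow>\<^sub>o postp_ty \<rightarrow>\<^sub>o postp_ty) P"
    using that by (auto simp: spn_Pi_Ord_iff hsub_ty_Pi_iff hsub_ty_postp_iff spn_Atom_iff)
  from assms(1) consider
    "c \<in> {times, plus}" "A = (postp_ty \<rightarrow>\<^sub>o postp_ty \<rightarrow>\<^sub>o postp_ty)"
    | "c \<in> {one, zero}" "A = postp_ty"
    | "c = zero_emp" "A = empty_ty (capp zero [])"
    | "c = plus_emp" "A = forall_T1_T2
       (empty_ty (dbv 1) \<rightarrow>\<^sub>o empty_ty (dbv 0) \<rightarrow>\<^sub>o empty_ty (capp plus [dbv 1, dbv 0]))"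
    | "c = times_emp_1" "A = forall_T1_T2 (empty_ty (dbv 1) \<rightarrow>\<^sub>o empty_ty (capp times [dbv 1, dbv 0]))"
    | "c = times_emp_2" "A = forall_T1_T2 (empty_ty (dbv 0) \<rightarrow>\<^sub>o empty_ty (capp times [dbv 1, dbv 0]))"
    by (auto simp: base_sig_def)
  then show ?thesis
  proof cases
    case 1
    with assms(2) arrows have "P = postp_ty" by (simp only:)
    with 1(1) that(1) show ?thesis by auto
  next
    case 2
    with assms(2) that(1) show ?thesis by (auto simp: spn_Atom_iff)
  next
    case 3
    with assms(2) that(2) show ?thesis by (simp add: spn_Atom_iff)
  next
    case 4
    with assms(2) obtain M1 M2 D1 D2 where "S = [Arg M1, Arg M2, Arg D1, Arg D2]"
      "chk \<Sigma> [] D1 (empty_ty M1)" "chk \<Sigma> [] D2 (empty_ty M2)" "P = empty_ty (capp plus [M1, M2])"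
      using spn_plus_emp_iff[of \<Sigma> S P] by (simp only:) (elim exE conjE, simp)
    with 4(1) show ?thesis using that(3) by simp
  next
    case 5
    with assms(2) obtain M1 M2 D where "S = [Arg M1, Arg M2, Arg D]"
      "chk \<Sigma> [] D (empty_ty M1)" "P = empty_ty (capp times [M1, M2])"
      using spn_times_emp_1_iff[of \<Sigma> S P] by (simp only:) (elim exE conjE, simp)
    with 5(1) show ?thesis using that(4) by simp
  next
    case 6
    with assms(2) obtain M1 M2 D where "S = [Arg M1, Arg M2, Arg D]"
      "chk \<Sigma> [] D (empty_ty M2)" "P = empty_ty (capp times [M1, M2])"
      using spn_times_emp_2_iff[of \<Sigma> S P] by (simp only:) (elim exE conjE, simp)
    with 6(1) show ?thesis using that(5) by simp
  qed
qed


section \<open>Unfolding in extensions of the encoded signature\<close>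

lemma rel_arg_Arg_iff: "rel_arg R (Arg x) b \<longleftrightarrow> (\<exists>y. b = Arg y \<and> R x y)"
  by (cases b) auto

lemma unfolds_Con_iff:
  "unfolds \<Sigma> (App (Con c) S) T \<longleftrightarrow>
     (\<exists>Ts. T = BApp (BCon c) Ts \<and> list_all2 (rel_arg (unfolds \<Sigma>)) S Ts)"
proof
  assume "unfolds \<Sigma> (App (Con c) S) T"
  then show "\<exists>Ts. T = BApp (BCon c) Ts \<and> list_all2 (rel_arg (unfolds \<Sigma>)) S Ts"
    by (rule unfolds_AppE) (erule hnf.cases; simp)
qed (auto intro: unfolds_App hnf_Con)

text \<open>On the empty spine \<open>hred\<close> returns the body unchanged, and a body headed by
  a constructor is already in head normal form.\<close>

lemma hnf_Rec_Nil_iff: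
  assumes "rec_functional \<Sigma>" "RecDecl r A (App (Con c) S) \<in> set \<Sigma>"
  shows "hnf \<Sigma> (App (Rec r) []) h S' \<longleftrightarrow> h = BCon c \<and> S' = S"
proof -
  have "hnf \<Sigma> (App (Rec r) []) (BCon c) S"
    by (rule hnf_Rec[OF assms(2) hred_Nil hnf_Con])
  then show ?thesis using hnf_functional[OF assms(1)] by metis
qed

lemma unfolds_Rec_Nil_iff:
  assumes "rec_functional \<Sigma>" "RecDecl r A (App (Con c) S) \<in> set \<Sigma>"
  shows "unfolds \<Sigma> (App (Rec r) []) T \<longleftrightarrow> unfolds \<Sigma> (App (Con c) S) T"
proof
  assume "unfolds \<Sigma> (App (Rec r) []) T"
  then show "unfolds \<Sigma> (App (Con c) S) T"
    by (rule unfolds_AppE) (auto simp: unfolds_Con_iff hnf_Rec_Nil_iff[OF assms])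
next
  assume "unfolds \<Sigma> (App (Con c) S) T"
  then obtain Ts where T: "T = BApp (BCon c) Ts" "list_all2 (rel_arg (unfolds \<Sigma>)) S Ts"
    by (auto simp: unfolds_Con_iff)
  show "unfolds \<Sigma> (App (Rec r) []) T"
    unfolding T(1) by (rule unfolds_App[OF _ T(2)]) (simp add: hnf_Rec_Nil_iff[OF assms])
qed

lemma unfolds_hnf_iff:
  assumes "rec_functional \<Sigma>" "hnf \<Sigma> (App h S) h' S'"
  shows "unfolds \<Sigma> (App h S) T \<longleftrightarrow> (\<exists>Ts. T = BApp h' Ts \<and> list_all2 (rel_arg (unfolds \<Sigma>)) S' Ts)"
proof
  assume "unfolds \<Sigma> (App h S) T"
  then show "\<exists>Ts. T = BApp h' Ts \<and> list_all2 (rel_arg (unfolds \<Sigma>)) S' Ts"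
    by (rule unfolds_AppE) (use hnf_functional[OF assms] in blast)
qed (auto intro: unfolds_App assms(2))

section \<open>Unfolding of type names\<close>

text \<open>Together with \<open>ptyp_names\<close> a uniform view of \<open>enc_ptyp\<close> as a
  constructor applied to names, which avoids splitting into four cases when unfolding.\<close>

fun ptyp_con :: "'t ptyp \<Rightarrow> con" where
  "ptyp_con (TimesT t1 t2) = times"
| "ptyp_con OneT = one"
| "ptyp_con (PlusT t1 t2) = plus"
| "ptyp_con ZeroT = zero"

fun ptyp_names :: "'t ptyp \<Rightarrow> 't list" where
  "ptyp_names (TimesT t1 t2) = [t1, t2]"
| "ptyp_names OneT = []"
| "ptyp_names (PlusT t1 t2) = [t1, t2]"
| "ptyp_names ZeroT = []"

lemma enc_ptyp_eq: "enc_ptyp \<tau> = App (Con (ptyp_con \<tau>)) (map (Arg \<circ> enc_name) (ptyp_names \<tau>))"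
  by (cases \<tau>) auto

lemma set_ptyp_names: "set (ptyp_names \<tau>) = set_ptyp \<tau>"
  by (cases \<tau>) auto

lemma hnf_enc_name:
  assumes "rec_functional \<Sigma>" "set (enc_sig \<Omega>) \<subseteq> set \<Sigma>" "(t, \<tau>) \<in> set \<Omega>"
  shows "hnf \<Sigma> (enc_name t) (BCon (ptyp_con \<tau>)) (map (Arg \<circ> enc_name) (ptyp_names \<tau>))"
proof -
  have "RecDecl (TName t) postp_ty (enc_ptyp \<tau>) \<in> set \<Sigma>"
    using assms(2,3) enc_sig_decls(3) by blast
  then show ?thesis
    unfolding enc_name_def enc_ptyp_eq by (simp add: hnf_Rec_Nil_iff[OF assms(1)])
qed

lemma unfolds_enc_name_iff:
  assumes "rec_functional \<Sigma>" "set (enc_sig \<Omega>) \<subseteq> set \<Sigma>" "(t, \<tau>) \<in> set \<Omega>"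
  shows "unfolds \<Sigma> (enc_name t) T \<longleftrightarrow> unfolds \<Sigma> (enc_ptyp \<tau>) T"
proof -
  have "RecDecl (TName t) postp_ty (enc_ptyp \<tau>) \<in> set \<Sigma>"
    using assms(2,3) enc_sig_decls(3) by blast
  then show ?thesis
    unfolding enc_name_def enc_ptyp_eq by (rule unfolds_Rec_Nil_iff[OF assms(1)])
qed

text \<open>The encoded names form an invariant set because a well-formed object signature defines
  every name it mentions.\<close>

lemma unfolds_enc_name_exists:
  assumes "wf_osig \<Omega>" "rec_functional \<Sigma>" "set (enc_sig \<Omega>) \<subseteq> set \<Sigma>" "t \<in> fst ` set \<Omega>"
  shows "\<exists>T. unfolds \<Sigma> (enc_name t) T"
proof (rule unfolds_exists[OF assms(2), where X = "enc_name ` fst ` set \<Omega>"])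
  fix M assume "M \<in> enc_name ` fst ` set \<Omega>"
  then obtain t \<tau> where t: "M = enc_name t" "(t, \<tau>) \<in> set \<Omega>" by auto
  have "set (ptyp_names \<tau>) \<subseteq> fst ` set \<Omega>"
    using assms(1) t(2) by (auto simp: wf_osig_def set_ptyp_names)
  with hnf_enc_name[OF assms(2,3) t(2)] t(1)
  show "\<exists>h S. hnf \<Sigma> M h S \<and> (\<forall>N. Arg N \<in> set S \<longrightarrow> N \<in> enc_name ` fst ` set \<Omega>)"
    by fastforce
qed (use assms in auto)

text \<open>The converse of monotonicity for type names: the unfolding that exists in the small
  signature persists in the large one, where uniqueness identifies it with \<open>T\<close>.\<close>

lemma unfolds_enc_name_restrict:
  assumes "wf_osig \<Omega>" "rec_functional \<Sigma>" "set (enc_sig \<Omega>) \<subseteq> set \<Sigma>" "t \<in> fst ` set \<Omega>"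
    and "unfolds \<Sigma> (enc_name t) T"
  shows "unfolds (enc_sig \<Omega>) (enc_name t) T"
proof -
  have "rec_functional (enc_sig \<Omega>)"
    using assms(2,3) unfolding rec_functional_def by blast
  then obtain T' where T': "unfolds (enc_sig \<Omega>) (enc_name t) T'"
    using unfolds_enc_name_exists[OF assms(1) _ order_refl assms(4)] by blast
  then have "T' = T"
    using unfolds_mono[OF T' assms(3)] unfolds_functional[OF assms(2)] assms(5) by blast
  with T' show ?thesis by simp
qed

section \<open>Well-formedness of the encoded signature\<close>

lemma chk_enc_name:
  assumes "set (enc_sig \<Omega>) \<subseteq> set \<Sigma>" "t \<in> fst ` set \<Omega>"
  shows "chk \<Sigma> \<Gamma> (enc_name t) postp_ty"
proof -
  obtain \<tau> where "(t, \<tau>) \<in> set \<Omega>" using assms(2) by auto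
  then have "RecDecl (TName t) postp_ty (enc_ptyp \<tau>) \<in> set \<Sigma>"
    using assms(1) enc_sig_decls(3) by blast
  then have "syn \<Sigma> \<Gamma> (enc_name t) postp_ty" unfolding enc_name_def syn_Rec_iff by (auto intro: spn_Nil)
  then show ?thesis unfolding chk_Atom_iff using ty_eq_postp by (auto simp: enc_name_def)
qed

lemma wf_decl_enc_sig:
  assumes "wf_osig \<Omega>" "set (enc_sig \<Omega>) \<subseteq> set \<Sigma>" "d \<in> set (enc_sig \<Omega>)"
  shows "wf_decl \<Sigma> d"
proof -
  have base: "set base_sig \<subseteq> set \<Sigma>" using assms(2) set_base_sig_subset by blast
  from assms(3) consider "d \<in> set base_sig"
    | t \<tau> where "(t, \<tau>) \<in> set \<Omega>" "d = RecDecl (TName t) postp_ty (enc_ptyp \<tau>)"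
    by (auto simp: enc_sig_def)
  then show ?thesis
  proof cases
    case 1
    then show ?thesis using wf_decl_base_sig[OF base] by blast
  next
    case 2
    have "set_ptyp \<tau> \<subseteq> fst ` set \<Omega>" using assms(1) 2(1) by (auto simp: wf_osig_def)
    then have names: "chk \<Sigma> [] (enc_name u) postp_ty" if "u \<in> set_ptyp \<tau>" for u
      using that chk_enc_name[OF assms(2)] by blast
    have con: "ConDecl times (postp_ty \<rightarrow>\<^sub>o postp_ty \<rightarrow>\<^sub>o postp_ty) \<in> set \<Sigma>"
      "ConDecl plus (postp_ty \<rightarrow>\<^sub>o postp_ty \<rightarrow>\<^sub>o postp_ty) \<in> set \<Sigma>"
      "ConDecl zero postp_ty \<in> set \<Sigma>" "ConDecl one postp_ty \<in> set \<Sigma>"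
      using base by (auto simp: base_sig_def)
    have "chk \<Sigma> [] (enc_ptyp \<tau>) postp_ty"
      using names by (cases \<tau>) (auto intro!: chk_postp_Con0 chk_postp_Con2 con[simplified])
    moreover have "wf_ty \<Sigma> [] postp_ty"
      using base by (auto simp: wf_ty_Atom_iff kspn_Cotype_iff base_sig_def intro!: exI[of _ Cotype])
    ultimately show ?thesis by (simp add: 2(2) enc_ptyp_eq)
  qed
qed

lemma wf_osig_functional:
  assumes "wf_osig \<Omega>" "(t, \<tau>) \<in> set \<Omega>" "(t, \<tau>') \<in> set \<Omega>"
  shows "\<tau> = \<tau>'"
  using assms eq_key_imp_eq_value unfolding wf_osig_def by metis

lemma distinct_enc_sig:
  assumes "wf_osig \<Omega>"
  shows "distinct (map decl_name (enc_sig \<Omega>))"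
proof -
  have "map decl_name (map (\<lambda>(t, \<tau>). RecDecl (TName t) postp_ty (enc_ptyp \<tau>)) \<Omega>) =
      map (\<lambda>t. RecName (TName t)) (map fst \<Omega>)"
    by auto
  moreover have "distinct (map (\<lambda>t. RecName (TName t)) (map fst \<Omega>))"
    using assms by (simp only: distinct_map[of _ "map fst \<Omega>"] wf_osig_def) (auto simp: inj_on_def)
  ultimately have "distinct (map decl_name (map (\<lambda>(t, \<tau>). RecDecl (TName t) postp_ty (enc_ptyp \<tau>)) \<Omega>))"
    by (simp only:)
  then show ?thesis by (auto simp: enc_sig_def base_sig_def)
qed

section \<open>Derivations and trees\<close>

text \<open>The implicit arguments are unfolded in \<open>enc_sig \<Omega>\<close> itself, so that
  the relation does not depend on the auxiliary recursion constants of a particular term.\<close>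

coinductive encodes :: "'t osig \<Rightarrow> 't deriv \<Rightarrow> 't \<Rightarrow> con btree \<Rightarrow> bool" for \<Omega> where
  encodes_Zero: "(t, ZeroT) \<in> set \<Omega> \<Longrightarrow> encodes \<Omega> (ZeroEmp t) t (BApp (BCon zero_emp) [])"
| encodes_Plus: "(t, PlusT t1 t2) \<in> set \<Omega> \<Longrightarrow>
    unfolds (enc_sig \<Omega>) (enc_name t1) T1 \<Longrightarrow> unfolds (enc_sig \<Omega>) (enc_name t2) T2 \<Longrightarrow>
    encodes \<Omega> d1 t1 U1 \<Longrightarrow> encodes \<Omega> d2 t2 U2 \<Longrightarrow>
    encodes \<Omega> (PlusEmp t d1 d2) t (BApp (BCon plus_emp) [Arg T1, Arg T2, Arg U1, Arg U2])"
| encodes_Times1: "(t, TimesT t1 t2) \<in> set \<Omega> \<Longrightarrow>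
    unfolds (enc_sig \<Omega>) (enc_name t1) T1 \<Longrightarrow> unfolds (enc_sig \<Omega>) (enc_name t2) T2 \<Longrightarrow>
    encodes \<Omega> d t1 U \<Longrightarrow>
    encodes \<Omega> (TimesEmp1 t d) t (BApp (BCon times_emp_1) [Arg T1, Arg T2, Arg U])"
| encodes_Times2: "(t, TimesT t1 t2) \<in> set \<Omega> \<Longrightarrow>
    unfolds (enc_sig \<Omega>) (enc_name t1) T1 \<Longrightarrow> unfolds (enc_sig \<Omega>) (enc_name t2) T2 \<Longrightarrow>
    encodes \<Omega> d t2 U \<Longrightarrow>
    encodes \<Omega> (TimesEmp2 t d) t (BApp (BCon times_emp_2) [Arg T1, Arg T2, Arg U])"

lemma derives_if_encodes: "encodes \<Omega> d t T \<Longrightarrow> derives \<Omega> d t"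
proof -
  assume "encodes \<Omega> d t T"
  then have "\<exists>T. encodes \<Omega> d t T" by blast
  then show ?thesis
    by (coinduct rule: derives.coinduct) (elim exE, erule encodes.cases; blast)
qed

text \<open>The last rule of the derivation fixes the root, the unique definition of
  \<open>t\<close> fixes the component names, and unique unfolding fixes the implicit arguments;
  bisimulation does the rest.\<close>

lemma encodes_functional:
  assumes wf: "wf_osig \<Omega>" and "encodes \<Omega> d t T" "encodes \<Omega> d t T'"
  shows "T = T'"
proof -
  have fn: "rec_functional (enc_sig \<Omega>)"
    using rec_functional_if_distinct[OF distinct_enc_sig[OF wf]] .
  have "\<exists>d t. encodes \<Omega> d t T \<and> encodes \<Omega> d t T'" using assms by blast
  then show ?thesis
  proof (coinduct rule: btree.coinduct_strong[consumes 1])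
    case (Eq_btree T T')
    then obtain d t where "encodes \<Omega> d t T" "encodes \<Omega> d t T'" by blast
    then show ?case
    proof (cases rule: encodes.cases[case_product encodes.cases])
      case (encodes_Plus_encodes_Plus t t1 t2 T1 T2 d1 U1 d2 U2 t' t1' t2' T1' T2' d1' U1' d2' U2')
      then have "t1 = t1'" "t2 = t2'" using wf_osig_functional[OF wf] by force+
      with encodes_Plus_encodes_Plus have "T1 = T1'" "T2 = T2'" using unfolds_functional[OF fn] by blast+
      with \<open>t1 = t1'\<close> \<open>t2 = t2'\<close> encodes_Plus_encodes_Plus show ?thesis by auto
    next
      case (encodes_Times1_encodes_Times1 t t1 t2 T1 T2 d1 U1 t' t1' t2' T1' T2' d1' U1')
      then have "t1 = t1'" "t2 = t2'" using wf_osig_functional[OF wf] by force+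
      with encodes_Times1_encodes_Times1 have "T1 = T1'" "T2 = T2'" using unfolds_functional[OF fn] by blast+
      with \<open>t1 = t1'\<close> \<open>t2 = t2'\<close> encodes_Times1_encodes_Times1 show ?thesis by auto
    next
      case (encodes_Times2_encodes_Times2 t t1 t2 T1 T2 d1 U1 t' t1' t2' T1' T2' d1' U1')
      then have "t1 = t1'" "t2 = t2'" using wf_osig_functional[OF wf] by force+
      with encodes_Times2_encodes_Times2 have "T1 = T1'" "T2 = T2'" using unfolds_functional[OF fn] by blast+
      with \<open>t1 = t1'\<close> \<open>t2 = t2'\<close> encodes_Times2_encodes_Times2 show ?thesis by auto
    qed auto
  qed
qed

text \<open>The root of the tree reveals the last rule. The shared name \<open>t\<close> is
  essential: it fixes the names of the premises, which the tree does not record.\<close>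

lemma encodes_injective:
  assumes wf: "wf_osig \<Omega>" and "encodes \<Omega> d t T" "encodes \<Omega> d' t T"
  shows "d = d'"
proof -
  have "\<exists>t T. encodes \<Omega> d t T \<and> encodes \<Omega> d' t T" using assms by blast
  then show ?thesis
  proof (coinduct rule: deriv.coinduct_strong[consumes 1])
    case (Eq_deriv d d')
    then obtain t T where "encodes \<Omega> d t T" "encodes \<Omega> d' t T" by blast
    then show ?case
    proof (cases rule: encodes.cases[case_product encodes.cases])
      case (encodes_Plus_encodes_Plus t t1 t2 T1 T2 d1 U1 d2 U2 t' t1' t2' T1' T2' d1' U1' d2' U2')
      then have "t1 = t1'" "t2 = t2'" using wf_osig_functional[OF wf] by force+
      with encodes_Plus_encodes_Plus show ?thesis by auto
    next
      case (encodes_Times1_encodes_Times1 t t1 t2 T1 T2 d1 U1 t' t1' t2' T1' T2' d1' U1')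
      then have "t1 = t1'" using wf_osig_functional[OF wf] by force
      with encodes_Times1_encodes_Times1 show ?thesis by auto
    next
      case (encodes_Times2_encodes_Times2 t t1 t2 T1 T2 d1 U1 t' t1' t2' T1' T2' d1' U1')
      then have "t2 = t2'" using wf_osig_functional[OF wf] by force
      with encodes_Times2_encodes_Times2 show ?thesis by auto
    qed auto
  qed
qed

text \<open>Recovers a premise's name from the conclusion's name. Meaningful only for names defined
  as a sum or a product.\<close>

definition left_name :: "'t osig \<Rightarrow> 't \<Rightarrow> 't" where
  "left_name \<Omega> t = ptyp_names (the (map_of \<Omega> t)) ! 0"

definition right_name :: "'t osig \<Rightarrow> 't \<Rightarrow> 't" where
  "right_name \<Omega> t = ptyp_names (the (map_of \<Omega> t)) ! 1"

lemma component_names: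
  assumes "wf_osig \<Omega>" "(t, \<tau>) \<in> set \<Omega>" "\<tau> = PlusT t1 t2 \<or> \<tau> = TimesT t1 t2"
  shows "left_name \<Omega> t = t1" "right_name \<Omega> t = t2"
  using assms by (auto simp: left_name_def right_name_def wf_osig_def)

lemma component_names_defined:
  assumes "wf_osig \<Omega>" "(t, \<tau>) \<in> set \<Omega>" "\<tau> = PlusT t1 t2 \<or> \<tau> = TimesT t1 t2"
  shows "t1 \<in> fst ` set \<Omega>" "t2 \<in> fst ` set \<Omega>"
  using assms by (fastforce simp: wf_osig_def)+


section \<open>From canonical forms to circular derivations\<close>

text \<open>The default sends trees of unexpected shape to a leaf under \<open>decode\<close>, which
  must be total.\<close>

definition root_con :: "con btree \<Rightarrow> con" where
  "root_con T = (case T of BApp (BCon c) Ts \<Rightarrow> c | _ \<Rightarrow> zero_emp)"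

definition child :: "nat \<Rightarrow> con btree \<Rightarrow> con btree" where
  "child n T = (case T of BApp h Ts \<Rightarrow> (case Ts ! n of Arg U \<Rightarrow> U | _ \<Rightarrow> T) | _ \<Rightarrow> T)"

text \<open>Positions 0 and 1 of the arguments hold the implicit arguments, so the trees of the
  premises start at position 2.\<close>

primcorec decode :: "'t osig \<Rightarrow> 't \<Rightarrow> con btree \<Rightarrow> 't deriv" where
  "decode \<Omega> t T =
    (if root_con T = plus_emp
     then PlusEmp t (decode \<Omega> (left_name \<Omega> t) (child 2 T)) (decode \<Omega> (right_name \<Omega> t) (child 3 T))
     else if root_con T = times_emp_1 then TimesEmp1 t (decode \<Omega> (left_name \<Omega> t) (child 2 T))
     else if root_con T = times_emp_2 then TimesEmp2 t (decode \<Omega> (right_name \<Omega> t) (child 2 T))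
     else ZeroEmp t)"

lemma decode_simps:
  "decode \<Omega> t (BApp (BCon zero_emp) []) = ZeroEmp t"
  "decode \<Omega> t (BApp (BCon plus_emp) [a, b, Arg U1, Arg U2]) =
     PlusEmp t (decode \<Omega> (left_name \<Omega> t) U1) (decode \<Omega> (right_name \<Omega> t) U2)"
  "decode \<Omega> t (BApp (BCon times_emp_1) [a, b, Arg U]) = TimesEmp1 t (decode \<Omega> (left_name \<Omega> t) U)"
  "decode \<Omega> t (BApp (BCon times_emp_2) [a, b, Arg U]) = TimesEmp2 t (decode \<Omega> (right_name \<Omega> t) U)"
  by (subst decode.code, simp add: root_con_def child_def)+

text \<open>Injectivity of the type constructors modulo unfolding: the root of a common tree
  determines the constructor, and its children witness equality of the components.\<close>

lemma tm_eq_Con_enc_name: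
  assumes "rec_functional \<Sigma>" "set (enc_sig \<Omega>) \<subseteq> set \<Sigma>" "(t, \<tau>) \<in> set \<Omega>"
    and "tm_eq \<Sigma> (capp c Ms) (enc_name t)"
  shows "c = ptyp_con \<tau> \<and> list_all2 (tm_eq \<Sigma>) Ms (map enc_name (ptyp_names \<tau>))"
proof -
  from assms(4) obtain T where "unfolds \<Sigma> (capp c Ms) T" "unfolds \<Sigma> (enc_ptyp \<tau>) T"
    unfolding tm_eq_def using unfolds_enc_name_iff[OF assms(1-3)] by blast
  then obtain Ts where c: "c = ptyp_con \<tau>"
    and Ts: "list_all2 (rel_arg (unfolds \<Sigma>)) (map Arg Ms) Ts"
      "list_all2 (rel_arg (unfolds \<Sigma>)) (map (Arg \<circ> enc_name) (ptyp_names \<tau>)) Ts"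
    by (auto simp: unfolds_Con_iff enc_ptyp_eq)
  have "length Ms = length (ptyp_names \<tau>)" using Ts[THEN list_all2_lengthD] by simp
  moreover have "tm_eq \<Sigma> (Ms ! i) (enc_name (ptyp_names \<tau> ! i))" if "i < length (ptyp_names \<tau>)" for i
    using that Ts calculation by (force simp: list_all2_conv_all_nth rel_arg_Arg_iff tm_eq_def)
  ultimately show ?thesis using c by (simp add: list_all2_conv_all_nth)
qed

lemma chk_empty_cong:
  assumes "rec_functional \<Sigma>" "chk \<Sigma> \<Gamma> D (empty_ty M)" "tm_eq \<Sigma> M N"
  shows "chk \<Sigma> \<Gamma> D (empty_ty N)"
proof -
  have "ty_eq \<Sigma> (empty_ty M) (empty_ty N)" using assms(3) by (simp add: ty_eq_Atom_iff)
  with assms(2) show ?thesis unfolding chk_Atom_iff using ty_eq_trans[OF assms(1)] by blast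
qed

text \<open>The invariant of the exploration. \<open>M\<close> stays fixed while \<open>t\<close>
  and \<open>T\<close> vary, so that the single finite set \<open>reach \<Sigma> M\<close> bounds
  all witnesses.\<close>

definition inhabits ::
  "'t osig \<Rightarrow> (fam, con, 't rname) lfsig \<Rightarrow> 't etm \<Rightarrow> 't \<Rightarrow> con btree \<Rightarrow> bool" where
  "inhabits \<Omega> \<Sigma> M t T \<longleftrightarrow> t \<in> fst ` set \<Omega> \<and>
     (\<exists>D \<in> reach \<Sigma> M. chk \<Sigma> [] D (empty_ty (enc_name t)) \<and> unfolds \<Sigma> D T)"

text \<open>The head normal form of the witness ends in a base constructor whose index equals
  \<open>enc_name t\<close> up to unfolding. Injectivity matches the implicit arguments with the
  component names, and conversion retypes the premises at those names.\<close>

lemma inhabits_cases: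
  assumes wf: "wf_osig \<Omega>" and \<Sigma>: "\<Sigma> = enc_sig \<Omega> @ \<Delta>" "\<forall>d \<in> set \<Delta>. is_RecDecl d" "wf_sig \<Sigma>"
    and inh: "inhabits \<Omega> \<Sigma> M t T"
  obtains (Zero) "(t, ZeroT) \<in> set \<Omega>" "T = BApp (BCon zero_emp) []"
  | (Plus) t1 t2 T1 T2 U1 U2 where "(t, PlusT t1 t2) \<in> set \<Omega>"
      "T = BApp (BCon plus_emp) [Arg T1, Arg T2, Arg U1, Arg U2]"
      "unfolds (enc_sig \<Omega>) (enc_name t1) T1" "unfolds (enc_sig \<Omega>) (enc_name t2) T2"
      "inhabits \<Omega> \<Sigma> M t1 U1" "inhabits \<Omega> \<Sigma> M t2 U2"
  | (Times1) t1 t2 T1 T2 U where "(t, TimesT t1 t2) \<in> set \<Omega>"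
      "T = BApp (BCon times_emp_1) [Arg T1, Arg T2, Arg U]"
      "unfolds (enc_sig \<Omega>) (enc_name t1) T1" "unfolds (enc_sig \<Omega>) (enc_name t2) T2"
      "inhabits \<Omega> \<Sigma> M t1 U"
  | (Times2) t1 t2 T1 T2 U where "(t, TimesT t1 t2) \<in> set \<Omega>"
      "T = BApp (BCon times_emp_2) [Arg T1, Arg T2, Arg U]"
      "unfolds (enc_sig \<Omega>) (enc_name t1) T1" "unfolds (enc_sig \<Omega>) (enc_name t2) T2"
      "inhabits \<Omega> \<Sigma> M t2 U"
proof -
  have fn: "rec_functional \<Sigma>" using \<Sigma>(3) by (simp add: wf_sig_def rec_functional_if_distinct)
  have sub: "set (enc_sig \<Omega>) \<subseteq> set \<Sigma>" using \<Sigma>(1) by auto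
  from inh obtain D \<tau> where t: "(t, \<tau>) \<in> set \<Omega>" and D: "D \<in> reach \<Sigma> M"
    and chk: "chk \<Sigma> [] D (empty_ty (enc_name t))" and unf: "unfolds \<Sigma> D T"
    by (auto simp: inhabits_def)
  from chk_Nil_AtomE[OF \<Sigma>(3) chk] obtain c S A P where
    reach: "\<And>N. Arg N \<in> set S \<Longrightarrow> N \<in> reach \<Sigma> M" and hnf: "hnf \<Sigma> D (BCon c) S"
    and con: "ConDecl c A \<in> set \<Sigma>" and spn: "spn \<Sigma> [] S A P"
    and eq: "ty_eq \<Sigma> P (empty_ty (enc_name t))"
    using D by metis
  \<comment> \<open>Neither the type definitions nor \<open>\<Delta>\<close> declare
    constructors.\<close>
  have base: "ConDecl c A \<in> set base_sig"
    using con \<Sigma>(1,2) by (auto simp: enc_sig_decls)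
  obtain h S0 where "D = App h S0" using chk by (auto simp: chk_Atom_iff)
  with unf hnf unfolds_hnf_iff[OF fn] obtain Ts where
    T: "T = BApp (BCon c) Ts" "list_all2 (rel_arg (unfolds \<Sigma>)) S Ts" by blast
  \<comment> \<open>An implicit argument need not be a type name, but it shares the tree of one, and
    that tree does not depend on \<open>\<Delta>\<close>.\<close>
  have tyarg: "unfolds (enc_sig \<Omega>) (enc_name u) V"
    if "tm_eq \<Sigma> N (enc_name u)" "unfolds \<Sigma> N V" "u \<in> fst ` set \<Omega>" for N u V
    using that unfolds_functional[OF fn] unfolds_enc_name_restrict[OF wf fn sub]
    unfolding tm_eq_def by metis
  \<comment> \<open>A premise is typed at its implicit argument \<open>N'\<close>; conversion moves
    it to the type name.\<close>
  have inhI: "inhabits \<Omega> \<Sigma> M u V"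
    if "chk \<Sigma> [] N (empty_ty N')" "tm_eq \<Sigma> N' (enc_name u)" "unfolds \<Sigma> N V" "u \<in> fst ` set \<Omega>"
      "Arg N \<in> set S" for N N' u V
    using that reach chk_empty_cong[OF fn] unfolding inhabits_def by blast
  have index: "tm_eq \<Sigma> N (enc_name t)" if "P = empty_ty N" for N
    using eq that by (simp add: ty_eq_Atom_iff)
  have names: "set_ptyp \<tau> \<subseteq> fst ` set \<Omega>" using wf t by (auto simp: wf_osig_def)
  note comp = tm_eq_Con_enc_name[OF fn sub t, OF index]
  from base spn show ?thesis
  proof (cases rule: base_sig_ConDecl)
    case 1
    with eq show ?thesis by (simp add: ty_eq_Atom_iff)
  next
    case 2
    with comp[of zero "[]"] have "\<tau> = ZeroT" by (cases \<tau>) auto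
    with t T 2 show ?thesis using Zero by auto
  next
    case (3 M1 M2 D1 D2)
    from comp[OF 3(5)] obtain t1 t2 where \<tau>: "\<tau> = PlusT t1 t2"
      and eqs: "tm_eq \<Sigma> M1 (enc_name t1)" "tm_eq \<Sigma> M2 (enc_name t2)"
      by (cases \<tau>) auto
    from T(2) 3(2) obtain T1 T2 U1 U2 where
      Ts: "Ts = [Arg T1, Arg T2, Arg U1, Arg U2]" "unfolds \<Sigma> M1 T1" "unfolds \<Sigma> M2 T2"
      "unfolds \<Sigma> D1 U1" "unfolds \<Sigma> D2 U2"
      by (auto simp: list_all2_Cons1 rel_arg_Arg_iff)
    have n: "t1 \<in> fst ` set \<Omega>" "t2 \<in> fst ` set \<Omega>" using names \<tau> by auto
    show ?thesis
      by (rule Plus[OF t[unfolded \<tau>] T(1)[unfolded Ts 3(1)]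
          tyarg[OF eqs(1) Ts(2) n(1)] tyarg[OF eqs(2) Ts(3) n(2)]
          inhI[OF 3(3) eqs(1) Ts(4) n(1)] inhI[OF 3(4) eqs(2) Ts(5) n(2)]]) (simp_all add: 3(2))
  next
    case (4 M1 M2 D1)
    from comp[OF 4(4)] obtain t1 t2 where \<tau>: "\<tau> = TimesT t1 t2"
      and eqs: "tm_eq \<Sigma> M1 (enc_name t1)" "tm_eq \<Sigma> M2 (enc_name t2)"
      by (cases \<tau>) auto
    from T(2) 4(2) obtain T1 T2 U where
      Ts: "Ts = [Arg T1, Arg T2, Arg U]" "unfolds \<Sigma> M1 T1" "unfolds \<Sigma> M2 T2" "unfolds \<Sigma> D1 U"
      by (auto simp: list_all2_Cons1 rel_arg_Arg_iff)
    have n: "t1 \<in> fst ` set \<Omega>" "t2 \<in> fst ` set \<Omega>" using names \<tau> by auto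
    show ?thesis
      by (rule Times1[OF t[unfolded \<tau>] T(1)[unfolded Ts 4(1)]
          tyarg[OF eqs(1) Ts(2) n(1)] tyarg[OF eqs(2) Ts(3) n(2)]
          inhI[OF 4(3) eqs(1) Ts(4) n(1)]]) (simp add: 4(2))
  next
    case (5 M1 M2 D1)
    from comp[OF 5(4)] obtain t1 t2 where \<tau>: "\<tau> = TimesT t1 t2"
      and eqs: "tm_eq \<Sigma> M1 (enc_name t1)" "tm_eq \<Sigma> M2 (enc_name t2)"
      by (cases \<tau>) auto
    from T(2) 5(2) obtain T1 T2 U where
      Ts: "Ts = [Arg T1, Arg T2, Arg U]" "unfolds \<Sigma> M1 T1" "unfolds \<Sigma> M2 T2" "unfolds \<Sigma> D1 U"
      by (auto simp: list_all2_Cons1 rel_arg_Arg_iff)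
    have n: "t1 \<in> fst ` set \<Omega>" "t2 \<in> fst ` set \<Omega>" using names \<tau> by auto
    show ?thesis
      by (rule Times2[OF t[unfolded \<tau>] T(1)[unfolded Ts 5(1)]
          tyarg[OF eqs(1) Ts(2) n(1)] tyarg[OF eqs(2) Ts(3) n(2)]
          inhI[OF 5(3) eqs(2) Ts(4) n(2)]]) (simp add: 5(2))
  qed
qed

text \<open>A term has at most one unfolding, so each pair is determined by a name and a reachable
  term.\<close>

lemma finite_inhabits:
  assumes "rec_functional \<Sigma>"
  shows "finite {(t, T). inhabits \<Omega> \<Sigma> M t T}"
proof (rule finite_subset)
  show "{(t, T). inhabits \<Omega> \<Sigma> M t T} \<subseteq>
      (\<lambda>(t, D). (t, THE T. unfolds \<Sigma> D T)) ` (fst ` set \<Omega> \<times> reach \<Sigma> M)"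
  proof clarify
    fix t T assume "inhabits \<Omega> \<Sigma> M t T"
    then obtain D where "t \<in> fst ` set \<Omega>" "D \<in> reach \<Sigma> M" "unfolds \<Sigma> D T"
      by (auto simp: inhabits_def)
    moreover from this(3) have "(THE T. unfolds \<Sigma> D T) = T"
      using unfolds_functional[OF assms] by (auto intro: the_equality)
    ultimately show "(t, T) \<in> (\<lambda>(t, D). (t, THE T. unfolds \<Sigma> D T)) ` (fst ` set \<Omega> \<times> reach \<Sigma> M)"
      by force
  qed
qed (simp add: finite_reach)

lemma decode_components:
  assumes wf: "wf_osig \<Omega>"
  shows "(t, PlusT t1 t2) \<in> set \<Omega> \<Longrightarrow> decode \<Omega> t (BApp (BCon plus_emp) [a, b, Arg U1, Arg U2]) =
      PlusEmp t (decode \<Omega> t1 U1) (decode \<Omega> t2 U2)"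
    and "(t, TimesT t1 t2) \<in> set \<Omega> \<Longrightarrow> decode \<Omega> t (BApp (BCon times_emp_1) [a, b, Arg U]) =
      TimesEmp1 t (decode \<Omega> t1 U)"
    and "(t, TimesT t1 t2) \<in> set \<Omega> \<Longrightarrow> decode \<Omega> t (BApp (BCon times_emp_2) [a, b, Arg U]) =
      TimesEmp2 t (decode \<Omega> t2 U)"
  using component_names[OF wf, of t _ t1 t2] by (simp_all add: decode_simps)

text \<open>The invariant \<open>inhabits\<close> serves twice: coinductively it yields the
  correspondence, and inductively it confines all subderivations to the \<open>decode\<close> image
  of a finite set.\<close>

lemma canonical_form_encodes:
  assumes wf: "wf_osig \<Omega>" and t: "t \<in> fst ` set \<Omega>"
    and T: "T \<in> canonical_forms (enc_sig \<Omega>) (empty_ty (enc_name t))"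
  shows "\<exists>d \<in> circular_derivations \<Omega> t. encodes \<Omega> d t T"
proof -
  from T obtain \<Delta> M where \<Delta>: "\<forall>d \<in> set \<Delta>. is_RecDecl d" "wf_sig (enc_sig \<Omega> @ \<Delta>)"
    and M: "chk (enc_sig \<Omega> @ \<Delta>) [] M (empty_ty (enc_name t))" "unfolds (enc_sig \<Omega> @ \<Delta>) M T"
    by (auto simp: canonical_forms_def)
  define \<Sigma> where "\<Sigma> = enc_sig \<Omega> @ \<Delta>"
  have fn: "rec_functional \<Sigma>" using \<Delta>(2) by (simp add: \<Sigma>_def wf_sig_def rec_functional_if_distinct)
  note cases = inhabits_cases[OF wf \<Sigma>_def \<Delta>(1) \<Delta>(2)[folded \<Sigma>_def],
      of M, case_names Zero Plus Times1 Times2, consumes 1]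
  have inh: "inhabits \<Omega> \<Sigma> M t T"
  proof -
    have "M \<in> reach \<Sigma> M" using self_in_subtms[of M] by (simp add: reach_def)
    with M t show ?thesis unfolding inhabits_def \<Sigma>_def by blast
  qed
  have "encodes \<Omega> (decode \<Omega> t T) t T"
    using conjI[OF refl inh]
  proof (coinduct rule: encodes.coinduct[where
        X = "\<lambda>d t T. d = decode \<Omega> t T \<and> inhabits \<Omega> \<Sigma> M t T"])
    case (encodes d t T)
    then have d: "d = decode \<Omega> t T" and "inhabits \<Omega> \<Sigma> M t T" by simp_all
    from this(2) show ?case
    proof (cases rule: cases)
      case Zero
      then show ?thesis unfolding d Zero(2) decode_simps(1) by simp
    next
      case (Plus t1 t2 T1 T2 U1 U2)
      then show ?thesis unfolding d Plus(2) decode_components(1)[OF wf Plus(1)] by auto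
    next
      case (Times1 t1 t2 T1 T2 U)
      then show ?thesis unfolding d Times1(2) decode_components(2)[OF wf Times1(1)] by auto
    next
      case (Times2 t1 t2 T1 T2 U)
      then show ?thesis unfolding d Times2(2) decode_components(3)[OF wf Times2(1)] by auto
    qed
  qed
  moreover have "finite (subderivs (decode \<Omega> t T))"
  proof (rule finite_subset)
    show "subderivs (decode \<Omega> t T) \<subseteq> (\<lambda>(t, T). decode \<Omega> t T) ` {(t, T). inhabits \<Omega> \<Sigma> M t T}"
    proof
      fix d assume "d \<in> subderivs (decode \<Omega> t T)"
      then have "\<exists>t T. d = decode \<Omega> t T \<and> inhabits \<Omega> \<Sigma> M t T"
      proof induction
        case 1
        then show ?case using inh by blast
      next
        case (2 u d1 d2)
        then obtain t T where eq: "decode \<Omega> t T = PlusEmp u d1 d2" and "inhabits \<Omega> \<Sigma> M t T" by auto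
        from this(2) show ?case
          by (cases rule: cases) (use eq in \<open>auto simp: decode_components[OF wf] decode_simps(1)\<close>)
      next
        case (3 u d1 d2)
        then obtain t T where eq: "decode \<Omega> t T = PlusEmp u d1 d2" and "inhabits \<Omega> \<Sigma> M t T" by auto
        from this(2) show ?case
          by (cases rule: cases) (use eq in \<open>auto simp: decode_components[OF wf] decode_simps(1)\<close>)
      next
        case (4 u d')
        then obtain t T where eq: "decode \<Omega> t T = TimesEmp1 u d'" and "inhabits \<Omega> \<Sigma> M t T" by auto
        from this(2) show ?case
          by (cases rule: cases) (use eq in \<open>auto simp: decode_components[OF wf] decode_simps(1)\<close>)
      next
        case (5 u d')
        then obtain t T where eq: "decode \<Omega> t T = TimesEmp2 u d'" and "inhabits \<Omega> \<Sigma> M t T" by auto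
        from this(2) show ?case
          by (cases rule: cases) (use eq in \<open>auto simp: decode_components[OF wf] decode_simps(1)\<close>)
      qed
      then show "d \<in> (\<lambda>(t, T). decode \<Omega> t T) ` {(t, T). inhabits \<Omega> \<Sigma> M t T}" by force
    qed
  qed (simp add: finite_inhabits[OF fn])
  ultimately show ?thesis by (auto simp: circular_derivations_def intro: derives_if_encodes)
qed

section \<open>From circular derivations to canonical forms\<close>

definition conclusion :: "'t deriv \<Rightarrow> 't" where
  "conclusion d = (case d of ZeroEmp t \<Rightarrow> t | PlusEmp t d1 d2 \<Rightarrow> t | TimesEmp1 t d \<Rightarrow> t |
     TimesEmp2 t d \<Rightarrow> t)"

lemma conclusion_eq: "derives \<Omega> d t \<Longrightarrow> conclusion d = t"
  by (erule derives.cases) (auto simp: conclusion_def)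

lemma conclusion_defined: "derives \<Omega> d t \<Longrightarrow> t \<in> fst ` set \<Omega>"
  by (erule derives.cases) force+

lemma derives_subderiv:
  assumes "d' \<in> subderivs d" "derives \<Omega> d t"
  shows "derives \<Omega> d' (conclusion d')"
  using assms(1)
proof induction
  case 1
  show ?case using assms(2) conclusion_eq[OF assms(2)] by simp
next
  case (2 u d1 d2)
  from 2(2) show ?case by cases (simp add: conclusion_eq)
next
  case (3 u d1 d2)
  from 3(2) show ?case by cases (simp add: conclusion_eq)
next
  case (4 u d')
  from 4(2) show ?case by cases (simp add: conclusion_eq)
next
  case (5 u d')
  from 5(2) show ?case by cases (simp add: conclusion_eq)
qed

definition aux_const :: "('t deriv \<Rightarrow> nat) \<Rightarrow> 't deriv \<Rightarrow> 't etm" where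
  "aux_const ix d = App (Rec (Aux (ix d))) []"

definition node_con :: "'t deriv \<Rightarrow> con" where
  "node_con d = (case d of ZeroEmp t \<Rightarrow> zero_emp | PlusEmp t d1 d2 \<Rightarrow> plus_emp |
     TimesEmp1 t d \<Rightarrow> times_emp_1 | TimesEmp2 t d \<Rightarrow> times_emp_2)"

text \<open>Every premise becomes a recursion constant, whether or not it closes a cycle. Bodies
  thus consist of one constructor applied to constants and are contractive.\<close>

definition node_args :: "'t osig \<Rightarrow> ('t deriv \<Rightarrow> nat) \<Rightarrow> 't deriv \<Rightarrow> 't etm list" where
  "node_args \<Omega> ix d = (case d of ZeroEmp t \<Rightarrow> [] |
     PlusEmp t d1 d2 \<Rightarrow> [enc_name (left_name \<Omega> t), enc_name (right_name \<Omega> t), aux_const ix d1, aux_const ix d2] |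
     TimesEmp1 t d \<Rightarrow> [enc_name (left_name \<Omega> t), enc_name (right_name \<Omega> t), aux_const ix d] |
     TimesEmp2 t d \<Rightarrow> [enc_name (left_name \<Omega> t), enc_name (right_name \<Omega> t), aux_const ix d])"

definition aux_decl ::
  "'t osig \<Rightarrow> ('t deriv \<Rightarrow> nat) \<Rightarrow> 't deriv \<Rightarrow> (fam, con, 't rname) decl" where
  "aux_decl \<Omega> ix d = RecDecl (Aux (ix d)) (empty_ty (enc_name (conclusion d)))
     (capp (node_con d) (node_args \<Omega> ix d))"

lemma tm_eq_enc_ptyp:
  assumes "wf_osig \<Omega>" "rec_functional \<Sigma>" "set (enc_sig \<Omega>) \<subseteq> set \<Sigma>" "(t, \<tau>) \<in> set \<Omega>"
  shows "tm_eq \<Sigma> (enc_ptyp \<tau>) (enc_name t)"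
proof -
  have "t \<in> fst ` set \<Omega>" using assms(4) by force
  then obtain T where "unfolds \<Sigma> (enc_name t) T"
    using unfolds_enc_name_exists[OF assms(1-3)] by blast
  then show ?thesis unfolding tm_eq_def using unfolds_enc_name_iff[OF assms(2-4)] by blast
qed

text \<open>A constructor produces the index \<open>enc_ptyp \<tau>\<close>, while the conclusion
  mentions the name \<open>t\<close>; conversion unfolds the definition once.\<close>

lemma chk_empty_Con:
  assumes "wf_osig \<Omega>" "rec_functional \<Sigma>" "set (enc_sig \<Omega>) \<subseteq> set \<Sigma>" "(t, \<tau>) \<in> set \<Omega>"
    and "ConDecl c A \<in> set \<Sigma>" "spn \<Sigma> \<Gamma> S A (empty_ty (enc_ptyp \<tau>))"
  shows "chk \<Sigma> \<Gamma> (App (Con c) S) (empty_ty (enc_name t))"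
proof -
  have "syn \<Sigma> \<Gamma> (App (Con c) S) (empty_ty (enc_ptyp \<tau>))"
    using assms(5,6) by (rule syn_Con)
  moreover have "ty_eq \<Sigma> (empty_ty (enc_ptyp \<tau>)) (empty_ty (enc_name t))"
    using tm_eq_enc_ptyp[OF assms(1-4)] by (simp add: ty_eq_Atom_iff)
  ultimately show ?thesis by (rule chk_App)
qed

text \<open>Checking a body consults only the declared types of the other recursion constants, so
  cyclic references need no fixed-point argument.\<close>

lemma circular_derivation_encodes:
  assumes wf: "wf_osig \<Omega>" and d0: "d0 \<in> circular_derivations \<Omega> t0"
  shows "\<exists>T \<in> canonical_forms (enc_sig \<Omega>) (empty_ty (enc_name t0)). encodes \<Omega> d0 t0 T"
proof -
  from d0 have der: "derives \<Omega> d0 t0" and fin: "finite (subderivs d0)"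
    by (auto simp: circular_derivations_def)
  from fin obtain ds where ds: "set ds = subderivs d0" "distinct ds"
    using finite_distinct_list by blast
  obtain ix :: "'a deriv \<Rightarrow> nat" where ix: "inj_on ix (subderivs d0)"
    using finite_imp_inj_to_nat_seg[OF fin] by blast
  define \<Delta> where "\<Delta> = map (aux_decl \<Omega> ix) ds"
  define \<Sigma> where "\<Sigma> = enc_sig \<Omega> @ \<Delta>"
  have sub: "set (enc_sig \<Omega>) \<subseteq> set \<Sigma>" by (auto simp: \<Sigma>_def)
  have base: "set base_sig \<subseteq> set \<Sigma>" using sub set_base_sig_subset by blast
  have subder: "derives \<Omega> d (conclusion d)" if "d \<in> subderivs d0" for d
    using derives_subderiv[OF that der] .
  have decl: "RecDecl (Aux (ix d)) (empty_ty (enc_name (conclusion d)))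
      (capp (node_con d) (node_args \<Omega> ix d)) \<in> set \<Sigma>" if "d \<in> subderivs d0" for d
    using that ds by (auto simp: \<Sigma>_def \<Delta>_def aux_decl_def)
  have dist: "distinct (map decl_name \<Sigma>)"
  proof -
    have "map decl_name \<Delta> = map (\<lambda>n. RecName (Aux n)) (map ix ds)"
      by (simp add: \<Delta>_def aux_decl_def)
    moreover have "distinct (map ix ds)" using ds ix by (simp add: distinct_map)
    then have "distinct (map (\<lambda>n. RecName (Aux n)) (map ix ds))"
      by (simp only: distinct_map[of _ "map ix ds"]) (simp add: inj_on_def)
    ultimately have "distinct (map decl_name \<Delta>)" by (simp only:)
    moreover have "decl_name ` set (enc_sig \<Omega>) \<inter> decl_name ` set \<Delta> = {}"
      by (auto simp: enc_sig_def base_sig_def \<Delta>_def aux_decl_def)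
    ultimately show ?thesis using distinct_enc_sig[OF wf] by (simp add: \<Sigma>_def)
  qed
  have fn: "rec_functional \<Sigma>" using rec_functional_if_distinct[OF dist] .
  have chk_aux: "chk \<Sigma> [] (aux_const ix d) (empty_ty (enc_name t))"
    if "d \<in> subderivs d0" "derives \<Omega> d t" for d t
  proof -
    have t: "conclusion d = t" "t \<in> fst ` set \<Omega>" using conclusion_eq[OF that(2)] conclusion_defined[OF that(2)] by simp_all
    have "syn \<Sigma> [] (aux_const ix d) (empty_ty (enc_name t))"
      unfolding aux_const_def using syn_Rec[OF decl[OF that(1)] spn_Nil] t by simp
    \<comment> \<open>Reflexivity at this type is exactly the existence of an unfolding of the
      name.\<close>
    moreover have "ty_eq \<Sigma> (empty_ty (enc_name t)) (empty_ty (enc_name t))"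
      using unfolds_enc_name_exists[OF wf fn sub t(2)] by (simp add: ty_eq_Atom_iff tm_eq_def)
    ultimately show ?thesis unfolding aux_const_def by (rule chk_App)
  qed
  have chk_body: "chk \<Sigma> [] (capp (node_con d) (node_args \<Omega> ix d)) (empty_ty (enc_name t))"
    if d: "d \<in> subderivs d0" and "derives \<Omega> d t" for d t
    using that(2)
  proof cases
    case 1
    have "ConDecl zero_emp (empty_ty (capp zero [])) \<in> set \<Sigma>" using base by (simp add: base_sig_def)
    from chk_empty_Con[OF wf fn sub 1(2) this, of "[]" "[]"] show ?thesis
      by (simp add: 1(1) node_con_def node_args_def spn_Nil)
  next
    case (2 t1 t2 d1 d2)
    have sd: "d1 \<in> subderivs d0" "d2 \<in> subderivs d0" using subderivs.intros(2,3)[OF d[unfolded 2(1)]] by simp_all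
    note n = component_names[OF wf 2(2), of t1 t2, simplified]
      component_names_defined[OF wf 2(2), of t1 t2, simplified]
    have "ConDecl plus_emp (forall_T1_T2
       (empty_ty (dbv 1) \<rightarrow>\<^sub>o empty_ty (dbv 0) \<rightarrow>\<^sub>o empty_ty (capp plus [dbv 1, dbv 0]))) \<in> set \<Sigma>"
      using base by (simp add: base_sig_def)
    moreover have "spn \<Sigma> [] [Arg (enc_name t1), Arg (enc_name t2), Arg (aux_const ix d1), Arg (aux_const ix d2)]
      (forall_T1_T2 (empty_ty (dbv 1) \<rightarrow>\<^sub>o empty_ty (dbv 0) \<rightarrow>\<^sub>o empty_ty (capp plus [dbv 1, dbv 0])))
      (empty_ty (enc_ptyp (PlusT t1 t2)))"
      unfolding spn_plus_emp_iff
      using chk_aux[OF sd(1) 2(3)] chk_aux[OF sd(2) 2(4)] by (simp add: chk_enc_name[OF sub] n(3,4))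
    ultimately have "chk \<Sigma> [] (App (Con plus_emp) (map Arg (node_args \<Omega> ix d))) (empty_ty (enc_name t))"
      unfolding 2(1) node_args_def deriv.case n(1,2) list.map by (rule chk_empty_Con[OF wf fn sub 2(2)])
    then show ?thesis unfolding 2(1) node_con_def deriv.case .
  next
    case (3 t1 t2 d1)
    have sd: "d1 \<in> subderivs d0" using subderivs.intros(4)[OF d[unfolded 3(1)]] .
    note n = component_names[OF wf 3(2), of t1 t2, simplified]
      component_names_defined[OF wf 3(2), of t1 t2, simplified]
    have "ConDecl times_emp_1
        (forall_T1_T2 (empty_ty (dbv 1) \<rightarrow>\<^sub>o empty_ty (capp times [dbv 1, dbv 0]))) \<in> set \<Sigma>"
      using base by (simp add: base_sig_def)
    moreover have "spn \<Sigma> [] [Arg (enc_name t1), Arg (enc_name t2), Arg (aux_const ix d1)]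
      (forall_T1_T2 (empty_ty (dbv 1) \<rightarrow>\<^sub>o empty_ty (capp times [dbv 1, dbv 0])))
      (empty_ty (enc_ptyp (TimesT t1 t2)))"
      unfolding spn_times_emp_1_iff
      using chk_aux[OF sd 3(3)] by (simp add: chk_enc_name[OF sub] n(3,4))
    ultimately have "chk \<Sigma> [] (App (Con times_emp_1) (map Arg (node_args \<Omega> ix d))) (empty_ty (enc_name t))"
      unfolding 3(1) node_args_def deriv.case n(1,2) list.map by (rule chk_empty_Con[OF wf fn sub 3(2)])
    then show ?thesis unfolding 3(1) node_con_def deriv.case .
  next
    case (4 t1 t2 d1)
    have sd: "d1 \<in> subderivs d0" using subderivs.intros(5)[OF d[unfolded 4(1)]] .
    note n = component_names[OF wf 4(2), of t1 t2, simplified]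
      component_names_defined[OF wf 4(2), of t1 t2, simplified]
    have "ConDecl times_emp_2
        (forall_T1_T2 (empty_ty (dbv 0) \<rightarrow>\<^sub>o empty_ty (capp times [dbv 1, dbv 0]))) \<in> set \<Sigma>"
      using base by (simp add: base_sig_def)
    moreover have "spn \<Sigma> [] [Arg (enc_name t1), Arg (enc_name t2), Arg (aux_const ix d1)]
      (forall_T1_T2 (empty_ty (dbv 0) \<rightarrow>\<^sub>o empty_ty (capp times [dbv 1, dbv 0])))
      (empty_ty (enc_ptyp (TimesT t1 t2)))"
      unfolding spn_times_emp_2_iff
      using chk_aux[OF sd 4(3)] by (simp add: chk_enc_name[OF sub] n(3,4))
    ultimately have "chk \<Sigma> [] (App (Con times_emp_2) (map Arg (node_args \<Omega> ix d))) (empty_ty (enc_name t))"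
      unfolding 4(1) node_args_def deriv.case n(1,2) list.map by (rule chk_empty_Con[OF wf fn sub 4(2)])
    then show ?thesis unfolding 4(1) node_con_def deriv.case .
  qed
  have wf\<Sigma>: "wf_sig \<Sigma>"
    unfolding wf_sig_def
  proof (intro conjI ballI dist)
    fix e assume "e \<in> set \<Sigma>"
    then consider "e \<in> set (enc_sig \<Omega>)" | d where "d \<in> subderivs d0" "e = aux_decl \<Omega> ix d"
      using ds by (auto simp: \<Sigma>_def \<Delta>_def)
    then show "wf_decl \<Sigma> e"
    proof cases
      case 1
      then show ?thesis using wf_decl_enc_sig[OF wf sub] by blast
    next
      case 2
      have "conclusion d \<in> fst ` set \<Omega>" using conclusion_defined[OF subder[OF 2(1)]] .
      then have "chk \<Sigma> [] (enc_name (conclusion d)) postp_ty" using chk_enc_name[OF sub] by blast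
      then have "wf_ty \<Sigma> [] (empty_ty (enc_name (conclusion d)))" using wf_ty_empty[OF base] by blast
      with chk_body[OF 2(1) subder[OF 2(1)]] show ?thesis by (simp add: 2(2) aux_decl_def)
    qed
  qed
  have hnf_aux: "hnf \<Sigma> (aux_const ix d) (BCon (node_con d)) (map Arg (node_args \<Omega> ix d))"
    if "d \<in> subderivs d0" for d
    unfolding aux_const_def by (simp add: hnf_Rec_Nil_iff[OF fn decl[OF that]])
  have args: "N \<in> enc_name ` fst ` set \<Omega> \<union> aux_const ix ` subderivs d0"
    if "d \<in> subderivs d0" "N \<in> set (node_args \<Omega> ix d)" "derives \<Omega> d t" for d N t
    using that(3)
  proof cases
    case 1
    with that(2) show ?thesis by (simp add: node_args_def)
  next
    case (2 t1 t2 d1 d2)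
    have "d1 \<in> subderivs d0" "d2 \<in> subderivs d0" using subderivs.intros(2,3)[OF that(1)[unfolded 2(1)]] by simp_all
    with that(2) component_names_defined[OF wf 2(2)] show ?thesis
      by (auto simp: 2(1) node_args_def component_names[OF wf 2(2)] intro: imageI)
  next
    case (3 t1 t2 d1)
    have "d1 \<in> subderivs d0" using subderivs.intros(4)[OF that(1)[unfolded 3(1)]] .
    with that(2) component_names_defined[OF wf 3(2)] show ?thesis
      by (auto simp: 3(1) node_args_def component_names[OF wf 3(2)] intro: imageI)
  next
    case (4 t1 t2 d1)
    have "d1 \<in> subderivs d0" using subderivs.intros(5)[OF that(1)[unfolded 4(1)]] .
    with that(2) component_names_defined[OF wf 4(2)] show ?thesis
      by (auto simp: 4(1) node_args_def component_names[OF wf 4(2)] intro: imageI)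
  qed
  obtain T0 where T0: "unfolds \<Sigma> (aux_const ix d0) T0"
  proof -
    \<comment> \<open>An invariant set: type names lead to type names, auxiliary constants to both
      kinds.\<close>
    let ?X = "enc_name ` fst ` set \<Omega> \<union> aux_const ix ` subderivs d0"
    have "\<exists>T. unfolds \<Sigma> (aux_const ix d0) T"
    proof (rule unfolds_exists[OF fn, where X = ?X])
      show "aux_const ix d0 \<in> ?X" by (simp add: subderivs.intros(1))
    next
      fix M assume "M \<in> ?X"
      then consider t \<tau> where "(t, \<tau>) \<in> set \<Omega>" "M = enc_name t"
        | d where "d \<in> subderivs d0" "M = aux_const ix d" by auto
      then show "\<exists>h S. hnf \<Sigma> M h S \<and> (\<forall>N. Arg N \<in> set S \<longrightarrow> N \<in> ?X)"
      proof cases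
        case 1
        have "set (ptyp_names \<tau>) \<subseteq> fst ` set \<Omega>"
          using wf 1(1) by (auto simp: wf_osig_def set_ptyp_names)
        then have "\<forall>N. Arg N \<in> set (map (Arg \<circ> enc_name) (ptyp_names \<tau>)) \<longrightarrow> N \<in> ?X" by auto
        with hnf_enc_name[OF fn sub 1(1)] 1(2) show ?thesis by blast
      next
        case 2
        have "\<forall>N. Arg N \<in> set (map Arg (node_args \<Omega> ix d)) \<longrightarrow> N \<in> ?X"
          using args[OF 2(1) _ subder[OF 2(1)]] by auto
        with hnf_aux[OF 2(1)] 2(2) show ?thesis by blast
      qed
    qed
    with that show ?thesis by blast
  qed
  have "encodes \<Omega> d0 t0 T0"
  proof -
    have "d0 \<in> subderivs d0 \<and> derives \<Omega> d0 t0 \<and> unfolds \<Sigma> (aux_const ix d0) T0"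
      using der T0 by (simp add: subderivs.intros(1))
    then show ?thesis
    proof (coinduct rule: encodes.coinduct[where X = "\<lambda>d t T.
          d \<in> subderivs d0 \<and> derives \<Omega> d t \<and> unfolds \<Sigma> (aux_const ix d) T"])
      case (encodes d t T)
      then have d: "d \<in> subderivs d0" "derives \<Omega> d t" "unfolds \<Sigma> (aux_const ix d) T" by auto
      from unfolds_hnf_iff[OF fn hnf_aux[OF d(1), unfolded aux_const_def], folded aux_const_def] d(3)
      obtain Ts where T: "T = BApp (BCon (node_con d)) Ts"
        "list_all2 (rel_arg (unfolds \<Sigma>)) (map Arg (node_args \<Omega> ix d)) Ts" by blast
      \<comment> \<open>The trees come from \<open>\<Sigma>\<close>, whereas \<open>encodes\<close>
        demands unfoldings in \<open>enc_sig \<Omega>\<close>.\<close>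
      note restrict = unfolds_enc_name_restrict[OF wf fn sub]
      from d(2) show ?case
      proof cases
        case 1
        with T show ?thesis by (simp add: node_con_def node_args_def)
      next
        case (2 t1 t2 d1 d2)
        have sd: "d1 \<in> subderivs d0" "d2 \<in> subderivs d0" using subderivs.intros(2,3)[OF d(1)[unfolded 2(1)]] by simp_all
        note n = component_names[OF wf 2(2), of t1 t2, simplified]
          component_names_defined[OF wf 2(2), of t1 t2, simplified]
        from T(2) obtain T1 T2 U1 U2 where "Ts = [Arg T1, Arg T2, Arg U1, Arg U2]"
          "unfolds \<Sigma> (enc_name t1) T1" "unfolds \<Sigma> (enc_name t2) T2"
          "unfolds \<Sigma> (aux_const ix d1) U1" "unfolds \<Sigma> (aux_const ix d2) U2"
          by (auto simp: 2(1) node_args_def n(1,2) list_all2_Cons1 rel_arg_Arg_iff)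
        with 2 T(1) sd restrict n(3,4) show ?thesis by (simp add: node_con_def) blast
      next
        case (3 t1 t2 d1)
        have sd: "d1 \<in> subderivs d0" using subderivs.intros(4)[OF d(1)[unfolded 3(1)]] .
        note n = component_names[OF wf 3(2), of t1 t2, simplified]
          component_names_defined[OF wf 3(2), of t1 t2, simplified]
        from T(2) obtain T1 T2 U where "Ts = [Arg T1, Arg T2, Arg U]"
          "unfolds \<Sigma> (enc_name t1) T1" "unfolds \<Sigma> (enc_name t2) T2" "unfolds \<Sigma> (aux_const ix d1) U"
          by (auto simp: 3(1) node_args_def n(1,2) list_all2_Cons1 rel_arg_Arg_iff)
        with 3 T(1) sd restrict n(3,4) show ?thesis by (simp add: node_con_def) blast
      next
        case (4 t1 t2 d1)
        have sd: "d1 \<in> subderivs d0" using subderivs.intros(5)[OF d(1)[unfolded 4(1)]] .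
        note n = component_names[OF wf 4(2), of t1 t2, simplified]
          component_names_defined[OF wf 4(2), of t1 t2, simplified]
        from T(2) obtain T1 T2 U where "Ts = [Arg T1, Arg T2, Arg U]"
          "unfolds \<Sigma> (enc_name t1) T1" "unfolds \<Sigma> (enc_name t2) T2" "unfolds \<Sigma> (aux_const ix d1) U"
          by (auto simp: 4(1) node_args_def n(1,2) list_all2_Cons1 rel_arg_Arg_iff)
        with 4 T(1) sd restrict n(3,4) show ?thesis by (simp add: node_con_def) blast
      qed
    qed
  qed
  moreover have "T0 \<in> canonical_forms (enc_sig \<Omega>) (empty_ty (enc_name t0))"
  proof -
    have "\<forall>e \<in> set \<Delta>. is_RecDecl e" by (auto simp: \<Delta>_def aux_decl_def)
    moreover have "chk \<Sigma> [] (aux_const ix d0) (empty_ty (enc_name t0))"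
      using chk_aux[OF subderivs.intros(1) der] .
    ultimately show ?thesis using wf\<Sigma> T0 unfolding canonical_forms_def \<Sigma>_def by blast
  qed
  ultimately show ?thesis by blast
qed

theorem theorem8:
  fixes \<Omega> :: "'t osig" and t :: 't
  assumes "wf_osig \<Omega>"
    and "t \<in> fst ` set \<Omega>"
  shows "\<exists>f. bij_betw f (circular_derivations \<Omega> t)
               (canonical_forms (enc_sig \<Omega>) (empty_ty (enc_name t)))"
proof -
  let ?D = "circular_derivations \<Omega> t" and ?C = "canonical_forms (enc_sig \<Omega>) (empty_ty (enc_name t))"
  \<comment> \<open>Any choice of partners works: uniqueness in one direction gives injectivity, and
    uniqueness in the other forces every canonical form to be the one chosen for its
    derivation.\<close>
  have "\<exists>f. \<forall>d \<in> ?D. f d \<in> ?C \<and> encodes \<Omega> d t (f d)"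
    using circular_derivation_encodes[OF assms(1)] by (intro bchoice) blast
  then obtain f where f: "\<And>d. d \<in> ?D \<Longrightarrow> f d \<in> ?C" "\<And>d. d \<in> ?D \<Longrightarrow> encodes \<Omega> d t (f d)"
    by blast
  have "inj_on f ?D" using f(2) encodes_injective[OF assms(1)] by (metis inj_onI)
  moreover have "?C \<subseteq> f ` ?D"
  proof
    fix T assume "T \<in> ?C"
    then obtain d where "d \<in> ?D" "encodes \<Omega> d t T" using canonical_form_encodes[OF assms] by blast
    moreover from this f(2) have "f d = T" using encodes_functional[OF assms(1)] by blast
    ultimately show "T \<in> f ` ?D" by blast
  qed
  ultimately have "bij_betw f ?D ?C" using f(1) by (auto simp: bij_betw_def)
  then show ?thesis by blast
qed

end
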